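(* Let $x_0\in(0,\infty)$, $\varepsilon_n=\sqrt{n^{-1}\log n}$, and $\sigma^2=\operatorname{Var}\left[\sin^{-1}\sqrt{1\wedge(x_0/Y)}\right]$ where $Y\sim G$. If $g(x_0)>0$ and $\sup_{t\in\mathbb R}|G_n(t)-G(t)|\to0$ as $n\to\infty$, then $$\sqrt n\int_{x_0}^\infty\frac{V_n^{\#}(u)-V_n(u)}{2\sqrt u}\,du\Rightarrow N(0,\sigma^2).$$ If also, with $c_n=1/\bigl(\sqrt{n\log n}+V_n(x_0)\bigr)^2$, as $n\to\infty$, (1) $V_n(x_0)\to V(x_0)$; (2) $n\left\{G_n\left(x_0+\frac1{\varepsilon^2n\log n}\right)-G_n(x_0)\right\}\to0$ for all $\varepsilon>0$; (3) $\int_{x_0}^{x_0+c_n}\frac{dG_n(y)}{\sqrt{y-x_0}}=o(\varepsilon_n)$; (4) $\frac1{\log n}\int_{x_0+c_n}^\infty\frac{dG_n(y)}{y-x_0}\to g(x_0)$, then $$\frac{F_n^{\#}(x_0)-F_n(x_0)}{\varepsilon_n}\Rightarrow N\left(0,\frac4{\pi^2}x_0g(x_0)\right).$$ Here $\Rightarrow$ denotes convergence in distribution.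
   Context: Model: $\mathbf X=(X_1,X_2,X_3)$ is a random vector in $\mathbb R^3$ with a density of the form $\rho(x_1^2+x_2^2+x_3^2)$. $Y=X_1^2+X_2^2$ has distribution function $G$ with density $g(y)=\pi\int_y^\infty\frac{\rho(z)}{\sqrt{z-y}}\,dz$, and $V(y)=\int_y^\infty\frac{g(u)}{\sqrt{u-y}}\,du=\pi^2\int_y^\infty\rho(z)\,dz$. The distribution function of $X_1^2+X_2^2+X_3^2$ is $F(x)=1+\frac2\pi\int_x^\infty\sqrt z\,dV(z)$. Triangular array: $G_n$, $n\ge1$, are (nonrandom) distribution functions on $[0,\infty)$; $T_1,T_2,\ldots$ are i.i.d. Uniform$(0,1)$; $Y_{n,i}=G_n^{-1}(T_i)$, $1\le i\le n$, where $G_n^{-1}(u)=\inf\{x:G_n(x)\ge u\}$ (so $Y_{n,1},\ldots,Y_{n,n}$ are i.i.d. with distribution function $G_n$). Define $$V_n(y)=\int_y^\infty\frac{dG_n(u)}{\sqrt{u-y}},\qquad V_n^{\#}(y)=\frac1n\sum_{i:\,Y_{n,i}>y}\frac1{\sqrt{Y_{n,i}-y}}.$$ Integrals $\int_y$ with respect to $dG_n$ are over points $u>y$. $F_n$ and $F_n^{\#}$ are obtained by replacing $V$ in $1+\frac2\pi\int_x^\infty\sqrt z\,dV(z)$ by $V_n$ and $V_n^{\#}$ respectively, the integral being understood through integration by parts: for $D=V_n$ or $V_n^{\#}$, $$1+\frac2\pi\int_x^\infty\sqrt z\,dD(z):=1-\frac2\pi\sqrt x\,D(x)-\frac2\pi\int_x^\infty\frac{D(u)}{2\sqrt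 u}\,du.$$ *)

theory Defs
  imports "HOL-Probability.Probability" "HOL-Library.Landau_Symbols"
begin

definition distribution_function_nonneg :: "(real \<Rightarrow> real) \<Rightarrow> bool" where
  "distribution_function_nonneg H \<longleftrightarrow>
     mono H \<and> (\<forall>t. continuous (at_right t) H) \<and> (\<forall>t<0. H t = 0) \<and> (H \<longlongrightarrow> 1) at_top"

definition quantile :: "(real \<Rightarrow> real) \<Rightarrow> real \<Rightarrow> real" where
  "quantile H u = Inf {x. H x \<ge> u}"

text \<open>The density \<open>g\<close> of \<open>X\<^sub>1\<^sup>2 + X\<^sub>2\<^sup>2\<close> and the function \<open>V\<close>, when \<open>X\<close> has the
  density \<open>\<rho> (x\<^sub>1\<^sup>2 + x\<^sub>2\<^sup>2 + x\<^sub>3\<^sup>2)\<close>.  A divergent integral has the value \<open>0\<close>, so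
  \<open>g y > 0\<close> includes finiteness of the integral defining \<open>g y\<close>.\<close>

definition sq_density :: "(real \<Rightarrow> real) \<Rightarrow> real \<Rightarrow> real" where
  "sq_density \<rho> y = pi * (LINT z:{y<..}|lborel. \<rho> z / sqrt (z - y))"

definition V_model :: "(real \<Rightarrow> real) \<Rightarrow> real \<Rightarrow> real" where
  "V_model \<rho> y = (LINT u:{y<..}|lborel. sq_density \<rho> u / sqrt (u - y))"

text \<open>The Lebesgue-Stieltjes measure \<open>dH\<close> is \<open>interval_measure H\<close>.\<close>

definition V_of :: "(real \<Rightarrow> real) \<Rightarrow> real \<Rightarrow> real" where
  "V_of H y = (LINT u:{y<..}|interval_measure H. 1 / sqrt (u - y))"

definition V_emp :: "nat \<Rightarrow> (nat \<Rightarrow> real) \<Rightarrow> real \<Rightarrow> real" where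
  "V_emp n y v = 1 / real n * (\<Sum>i | i \<in> {1..n} \<and> y i > v. 1 / sqrt (y i - v))"

text \<open>\<open>1 + 2/\<pi> \<integral>\<^sub>x\<^sup>\<infinity> \<surd>z dD(z)\<close>, understood through integration by parts.\<close>

definition F_of :: "(real \<Rightarrow> real) \<Rightarrow> real \<Rightarrow> real" where
  "F_of D x = 1 - 2 / pi * sqrt x * D x
     - 2 / pi * (LINT u:{x<..}|lborel. D u / (2 * sqrt u))"

definition eps_seq :: "nat \<Rightarrow> real" where
  "eps_seq n = sqrt (ln (real n) / real n)"

definition c_seq :: "(nat \<Rightarrow> real \<Rightarrow> real) \<Rightarrow> real \<Rightarrow> nat \<Rightarrow> real" where
  "c_seq G x n = 1 / (sqrt (real n * ln (real n)) + V_of (G n) x)\<^sup>2"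

text \<open>\<open>N(0, v)\<close>, parametrised by its variance \<open>v > 0\<close>; \<open>normal_density\<close> takes the
  standard deviation.\<close>

definition centered_normal :: "real \<Rightarrow> real measure" where
  "centered_normal v = density lborel (normal_density 0 (sqrt v))"

end

theory Submission imports Defs begin

text \<open>Write \<open>A y = arccos (sqrt (x\<^sub>0 / y))\<close> for \<open>y > x\<^sub>0\<close> and \<open>A y = 0\<close> otherwise
(\<open>tail_angle\<close>).  The integral of \<open>1 / (2 sqrt u sqrt (y - u))\<close> over \<open>x\<^sub>0 < u < y\<close> is \<open>A y\<close>, so by
Tonelli the integrals of \<open>V_emp\<close> and \<open>V_of\<close> against \<open>du / (2 sqrt u)\<close> are the empirical and the
true mean of \<open>A\<close>.  The first statistic is therefore the normalised sum of the bounded centred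
variables \<open>A Y - E (A Y)\<close>.  Uniform convergence of the distribution functions implies weak
convergence, and \<open>A\<close> is bounded and continuous, so the variances converge to the variance of
\<open>A Y = \<pi>/2 - arcsin (sqrt (min 1 (x\<^sub>0 / Y)))\<close> (for \<open>Y > 0\<close>), and the central limit theorem for triangular arrays
applies.

For the second statement the definition through integration by parts splits the error of \<open>F\<close> into
\<open>- 2/\<pi> sqrt x\<^sub>0\<close> times the error of \<open>V\<close> at \<open>x\<^sub>0\<close> and a multiple of the integral above.  The latter
has standard deviation at most of order \<open>1 / sqrt n\<close>, which is negligible compared with \<open>eps_seq n\<close>.  The
former, divided by \<open>eps_seq n\<close>, is a multiple of a sum of \<open>n\<close> independent copies of \<open>\<xi> = 1 / sqrt (Y - x\<^sub>0)\<close> (zero for \<open>Y \<le> x\<^sub>0\<close>), centred at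
\<open>m = V_of (Gn n) x\<^sub>0\<close> and divided by \<open>s = sqrt (n log n) = n eps_seq n\<close>.  The variance of \<open>\<xi>\<close> need not be
finite, so the sum has to be truncated.  The event that \<open>(\<xi> - m) / s\<close> reaches \<open>1\<close> is
\<open>x\<^sub>0 < Y \<le> x\<^sub>0 + c_seq\<close>, and the hypotheses on \<open>Gn\<close> become those of the central limit theorem
for null arrays (\<open>rowwise_iid_central_limit_theorem\<close>): the condition on the increments of \<open>Gn\<close> to the
right of \<open>x\<^sub>0\<close> makes the tails negligible, the integral over the cutoff interval is the deviation of
the truncated mean from \<open>m\<close>, and the integral of \<open>1 / (y - x\<^sub>0)\<close> beyond the cutoff is the truncated
second moment of \<open>\<xi>\<close>, which after division by \<open>log n\<close> tends to \<open>g x\<^sub>0\<close>.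

Two properties of the model enter.  The variance of \<open>A Y\<close> is positive, because \<open>Y\<close> has no atoms and
exceeds \<open>x\<^sub>0\<close> with positive probability.  And \<open>V_model \<rho> x\<^sub>0\<close> is positive, so that
\<open>V_of (Gn n) x\<^sub>0 \<noteq> 0\<close> eventually; as divergent integrals have the value \<open>0\<close>, this is what makes \<open>\<xi>\<close>
integrable.  Both positivity claims rest on the density \<open>2 \<pi> sqrt z \<rho> z\<close> of the squared norm of \<open>X\<close>.\<close>

section \<open>A central limit theorem for rowwise independent and identically distributed arrays\<close>

lemma char_centered_normal:
  assumes "v > 0"
  shows "char (centered_normal v) t = complex_of_real (exp (- (t\<^sup>2 * v) / 2))"
proof -
  interpret S: prob_space std_normal_distribution
    using prob_space_normal_density by simp
  have "distributed std_normal_distribution lborel (\<lambda>x. x) std_normal_density"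
    unfolding distributed_def by (auto simp: distr_id2)
  then have "distributed std_normal_distribution lborel (\<lambda>x. 0 + sqrt v * x)
      (normal_density (0 + sqrt v * 0) (\<bar>sqrt v\<bar> * 1))"
    using assms by (intro S.normal_density_affine) auto
  then have *: "centered_normal v = distr std_normal_distribution borel (\<lambda>x. sqrt v * x)"
    using assms by (auto simp: distributed_def centered_normal_def cong: distr_cong)
  have "char (centered_normal v) t = char std_normal_distribution (t * sqrt v)"
    unfolding * char_def by (subst integral_distr) (auto simp: mult_ac)
  also have "\<dots> = complex_of_real (exp (- (t\<^sup>2 * v) / 2))"
    using assms by (simp add: char_std_normal_distribution power_mult_distrib)
  finally show ?thesis .
qed

lemma real_distribution_centered_normal:
  assumes "v > 0" shows "real_distribution (centered_normal v)"
  using prob_space_normal_density[of "sqrt v" 0] assms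
  by (auto simp: real_distribution_def real_distribution_axioms_def centered_normal_def)

text \<open>Replacing \<open>z n\<close> by \<open>1 + c / n\<close> costs at most \<open>n\<close> times their distance, as both have modulus at most
\<open>1\<close>; the condition \<open>c \<le> 0\<close> provides this for \<open>1 + c / n\<close> with \<open>n\<close> large.\<close>

lemma power_tendsto_exp:
  fixes z :: "nat \<Rightarrow> complex" and c :: real
  assumes z: "\<And>n. norm (z n) \<le> 1" and "c \<le> 0"
    and lim: "(\<lambda>n. of_nat n * (z n - 1)) \<longlonglongrightarrow> of_real c"
  shows "(\<lambda>n. z n ^ n) \<longlonglongrightarrow> of_real (exp c)"
proof -
  define w where "w n = complex_of_real (1 + c / real n)" for n
  have w: "norm (w n) \<le> 1" if "real n \<ge> - c" "n > 0" for n
    using that \<open>c \<le> 0\<close> unfolding w_def norm_of_real by (simp add: abs_le_iff field_simps)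
  have "\<forall>\<^sub>F n in sequentially. real n \<ge> - c"
    using filterlim_real_sequentially by (auto simp: filterlim_at_top)
  then have "\<forall>\<^sub>F n in sequentially. norm (z n ^ n - w n ^ n) \<le> norm (of_nat n * (z n - 1) - of_real c)"
    using eventually_gt_at_top[of 0]
  proof eventually_elim
    case (elim n)
    have "norm (z n ^ n - w n ^ n) \<le> n * norm (z n - w n)"
      using z w elim by (intro norm_power_diff) auto
    also have "\<dots> = norm (of_nat n * (z n - w n))" by (simp add: norm_mult)
    also have "of_nat n * (z n - w n) = of_nat n * (z n - 1) - of_real c"
      using elim by (simp add: w_def field_simps)
    finally show ?case .
  qed
  moreover have "(\<lambda>n. norm (of_nat n * (z n - 1) - of_real c)) \<longlonglongrightarrow> 0"
    using lim by (simp add: LIM_zero_iff tendsto_norm_zero_iff)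
  ultimately have 1: "(\<lambda>n. z n ^ n - w n ^ n) \<longlonglongrightarrow> 0"
    by (rule Lim_null_comparison)
  have "(\<lambda>n. complex_of_real ((1 + c / real n) ^ n)) \<longlonglongrightarrow> of_real (exp c)"
    by (intro tendsto_of_real tendsto_exp_limit_sequentially)
  then have "(\<lambda>n. w n ^ n) \<longlonglongrightarrow> of_real (exp c)" by (simp add: w_def)
  from tendsto_add[OF 1 this] show ?thesis by simp
qed

text \<open>The remainder of the second-order expansion is \<open>\<delta>\<close> times a second moment plus multiples of
indicators of tail regions.  In a null array the indicator terms vanish after integration and
multiplication by \<open>n\<close>, whatever \<open>\<delta>\<close> is, and then \<open>\<delta>\<close> can be taken small.\<close>

lemma iexp_truncated_expansion:
  fixes t x \<delta> :: real
  assumes "\<delta> > 0"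
  defines "y \<equiv> x * indicator {-1<..<1} x"
  shows "norm (iexp (t * x) - (1 + \<i> * of_real (t * y) - of_real (t\<^sup>2 * y\<^sup>2 / 2)))
    \<le> 2 * indicator {x. 1 \<le> \<bar>x\<bar>} x + \<bar>t\<bar> ^ 3 * \<delta> * y\<^sup>2 + t\<^sup>2 * indicator {x. \<delta> \<le> \<bar>x\<bar>} x"
proof -
  consider "\<bar>x\<bar> \<ge> 1" | "\<bar>x\<bar> < 1" "\<bar>x\<bar> < \<delta>" | "\<bar>x\<bar> < 1" "\<delta> \<le> \<bar>x\<bar>" by linarith
  then show ?thesis
  proof cases
    case 1
    have "norm (iexp (t * x) - 1) \<le> norm (iexp (t * x)) + norm (1::complex)"
      by (rule norm_triangle_ineq4)
    then have "norm (iexp (t * x) - 1) \<le> 2" by (simp del: of_real_mult)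
    moreover have "y = 0" using 1 by (auto simp: y_def indicator_def)
    ultimately show ?thesis using 1 assms(1) by (simp add: add_increasing2)
  next
    case 2
    then have y: "y = x" by (auto simp: y_def indicator_def)
    have eq: "1 + \<i> * of_real (t * y) - of_real (t\<^sup>2 * y\<^sup>2 / 2) = (\<Sum>k\<le>2. (\<i> * of_real (t * x))^k / fact k)"
      by (simp add: y eval_nat_numeral algebra_simps power2_eq_square)
    have "norm (iexp (t * x) - (1 + \<i> * of_real (t * y) - of_real (t\<^sup>2 * y\<^sup>2 / 2))) \<le> \<bar>t * x\<bar> ^ 3 / 6"
      unfolding eq using iexp_approx1[of "t * x" 2] by (simp add: eval_nat_numeral)
    also have "\<dots> \<le> \<bar>t * x\<bar> ^ 3" by simp
    also have "\<dots> = \<bar>t\<bar> ^ 3 * \<bar>x\<bar> * \<bar>x\<bar>\<^sup>2"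
      by (simp only: abs_mult power_mult_distrib power3_eq_cube power2_eq_square mult_ac)
    also have "\<dots> = \<bar>t\<bar> ^ 3 * \<bar>x\<bar> * x\<^sup>2" by simp
    also have "\<dots> \<le> \<bar>t\<bar> ^ 3 * \<delta> * x\<^sup>2"
      using 2 by (intro mult_right_mono mult_left_mono) auto
    finally show ?thesis using 2 by (simp add: y)
  next
    case 3
    then have y: "y = x" by (auto simp: y_def indicator_def)
    have eq: "1 + \<i> * of_real (t * y) - of_real (t\<^sup>2 * y\<^sup>2 / 2) = (\<Sum>k\<le>2. (\<i> * of_real (t * x))^k / fact k)"
      by (simp add: y eval_nat_numeral algebra_simps power2_eq_square)
    have "norm (iexp (t * x) - (1 + \<i> * of_real (t * y) - of_real (t\<^sup>2 * y\<^sup>2 / 2))) \<le> (t * x)\<^sup>2"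
      unfolding eq using iexp_approx2[of "t * x" 2] by simp
    also have "\<dots> \<le> t\<^sup>2"
      using 3 by (simp add: power_mult_distrib mult_left_le abs_square_le_1)
    finally show ?thesis using 3 assms(1) by (simp add: y add_increasing)
  qed
qed

lemma (in real_distribution) char_truncated_expansion:
  fixes t \<delta> :: real
  assumes "\<delta> > 0"
  defines "m1 \<equiv> (\<integral>x. x * indicator {-1<..<1} x \<partial>M)"
    and "m2 \<equiv> (\<integral>x. x\<^sup>2 * indicator {-1<..<1} x \<partial>M)"
  shows "norm (char M t - (1 + \<i> * of_real (t * m1) - of_real (t\<^sup>2 * m2 / 2)))
    \<le> 2 * measure M {x. 1 \<le> \<bar>x\<bar>} + \<bar>t\<bar> ^ 3 * \<delta> * m2 + t\<^sup>2 * measure M {x. \<delta> \<le> \<bar>x\<bar>}"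
proof -
  let ?y = "\<lambda>x::real. x * indicator {-1<..<1} x"
  let ?R = "\<lambda>x. iexp (t * x) - (1 + \<i> * of_real (t * ?y x) - of_real (t\<^sup>2 * (?y x)\<^sup>2 / 2))"
  have y2: "(?y x)\<^sup>2 = x\<^sup>2 * indicator {-1<..<1} x" for x :: real
    by (auto simp: indicator_def)
  have [simp]: "integrable M ?y"
    by (rule integrable_const_bound[where B=1]) (auto simp: indicator_def)
  have [simp]: "integrable M (\<lambda>x. x\<^sup>2 * indicator {-1<..<1} x)"
    by (rule integrable_const_bound[where B=1]) (auto simp: indicator_def abs_square_le_1)
  have [simp]: "integrable M (\<lambda>x. iexp (t * x))"
    by (intro integrable_const_bound[where B=1]) auto
  have ind: "integrable M (indicator {x. c \<le> \<bar>x\<bar>} :: real \<Rightarrow> real)" for c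
    by (rule integrable_const_bound[where B=1]) (auto simp: indicator_def)
  have int: "integrable M ?R" unfolding y2
    by (intro Bochner_Integration.integrable_add Bochner_Integration.integrable_diff
        integrable_mult_right integrable_of_real integrable_divide) (simp_all del: of_real_mult)
  have R: "char M t - (1 + \<i> * of_real (t * m1) - of_real (t\<^sup>2 * m2 / 2)) = (\<integral>x. ?R x \<partial>M)"
    unfolding y2 char_def m1_def m2_def
    by (subst Bochner_Integration.integral_diff Bochner_Integration.integral_add | 
      simp del: space_eq_univ of_real_mult of_real_divide add: prob_space)+
  have "norm (char M t - (1 + \<i> * of_real (t * m1) - of_real (t\<^sup>2 * m2 / 2))) \<le> (\<integral>x. norm (?R x) \<partial>M)"
    unfolding R by (rule integral_norm_bound)
  also have "\<dots> \<le> (\<integral>x. 2 * indicator {x. 1 \<le> \<bar>x\<bar>} x + \<bar>t\<bar> ^ 3 * \<delta> * (?y x)\<^sup>2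
       + t\<^sup>2 * indicator {x. \<delta> \<le> \<bar>x\<bar>} x \<partial>M)"
  proof (rule integral_mono)
    show "integrable M (\<lambda>x. norm (?R x))" using int by (rule integrable_norm)
    show "integrable M (\<lambda>x. 2 * indicator {x. 1 \<le> \<bar>x\<bar>} x + \<bar>t\<bar> ^ 3 * \<delta> * (?y x)\<^sup>2
       + t\<^sup>2 * indicator {x. \<delta> \<le> \<bar>x\<bar>} x)"
      unfolding y2 by (intro Bochner_Integration.integrable_add integrable_mult_right ind) simp
  qed (rule iexp_truncated_expansion[OF assms(1)])
  also have "\<dots> = 2 * (\<integral>x. indicator {x. 1 \<le> \<bar>x\<bar>} x \<partial>M) + \<bar>t\<bar> ^ 3 * \<delta> * m2
       + t\<^sup>2 * (\<integral>x. indicator {x. \<delta> \<le> \<bar>x\<bar>} x \<partial>M)"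
    unfolding y2 m2_def
    by (subst Bochner_Integration.integral_add,
        (intro Bochner_Integration.integrable_add integrable_mult_right ind; simp)+)+
      (simp only: integral_mult_right_zero)
  finally show ?thesis by simp
qed

text \<open>A normal convergence criterion in terms of moments truncated at \<open>1\<close>, so that the second moment of
the rows may be infinite.  The truncation is strict (\<open>\<bar>x\<bar> < 1\<close>), which matches the closed
right end of the interval \<open>{x\<^sub>0<..x\<^sub>0 + c_seq Gn x\<^sub>0 n}\<close> in the application.  The truncated expansion shows
that \<open>n (\<phi>\<^sub>n t - 1)\<close> tends to \<open>- t\<^sup>2 v / 2\<close> for the characteristic functions \<open>\<phi>\<^sub>n\<close> of the rows.\<close>

theorem (in prob_space) rowwise_iid_central_limit_theorem:
  fixes W :: "nat \<Rightarrow> nat \<Rightarrow> 'a \<Rightarrow> real" and \<mu> :: "nat \<Rightarrow> real measure"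
  assumes indep: "\<And>n. indep_vars (\<lambda>_. borel) (W n) {1..n}"
    and law: "\<And>n i. i \<in> {1..n} \<Longrightarrow> distr M borel (W n i) = \<mu> n"
    and tail: "\<And>\<delta>. \<delta> > 0 \<Longrightarrow> (\<lambda>n. real n * measure (\<mu> n) {x. \<delta> \<le> \<bar>x\<bar>}) \<longlonglongrightarrow> 0"
    and mean: "(\<lambda>n. real n * (\<integral>x. x * indicator {-1<..<1} x \<partial>\<mu> n)) \<longlonglongrightarrow> 0"
    and var: "(\<lambda>n. real n * (\<integral>x. x\<^sup>2 * indicator {-1<..<1} x \<partial>\<mu> n)) \<longlonglongrightarrow> v"
    and "v > 0"
  shows "weak_conv_m (\<lambda>n. distr M borel (\<lambda>\<omega>. \<Sum>i=1..n. W n i \<omega>)) (centered_normal v)"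
proof (rule levy_continuity)
  have W[measurable]: "W n i \<in> borel_measurable M" if "i \<in> {1..n}" for n i
    using indep[of n] that by (auto simp: indep_vars_def)
  have dist: "real_distribution (\<mu> n)" if "n \<ge> 1" for n
    using law[of 1 n] W[of 1 n] that by (metis atLeastAtMost_iff order_refl real_distribution_distr)
  show "real_distribution (distr M borel (\<lambda>\<omega>. \<Sum>i=1..n. W n i \<omega>))" for n
    by (intro real_distribution_distr borel_measurable_sum) auto
  show "real_distribution (centered_normal v)"
    by (rule real_distribution_centered_normal) fact
  fix t
  define z where "z n = (if n = 0 then 1 else char (\<mu> n) t)" for n
  have z1: "norm (z n) \<le> 1" for n
    using real_distribution.cmod_char_le_1[OF dist[of n]] by (auto simp: z_def)
  have z_pow: "char (distr M borel (\<lambda>\<omega>. \<Sum>i=1..n. W n i \<omega>)) t = z n ^ n" for n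
  proof -
    have "char (distr M borel (\<lambda>\<omega>. \<Sum>i=1..n. W n i \<omega>)) t = (\<Prod>i=1..n. char (distr M borel (W n i)) t)"
      by (rule char_distr_sum[OF indep])
    also have "\<dots> = z n ^ n" by (auto simp: law z_def)
    finally show ?thesis .
  qed
  define m1 where "m1 n = (\<integral>x. x * indicator {-1<..<1} x \<partial>\<mu> n)" for n
  define m2 where "m2 n = (\<integral>x. x\<^sup>2 * indicator {-1<..<1} x \<partial>\<mu> n)" for n
  define p where "p \<delta> n = real n * measure (\<mu> n) {x. \<delta> \<le> \<bar>x\<bar>}" for \<delta> n
  define r where "r n = of_nat n * (z n - (1 + \<i> * of_real (t * m1 n) - of_real (t\<^sup>2 * m2 n / 2)))" for n
  have r_le: "norm (r n) \<le> 2 * p 1 n + \<bar>t\<bar> ^ 3 * \<delta> * (real n * m2 n) + t\<^sup>2 * p \<delta> n" if "\<delta> > 0" for n \<delta>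
  proof (cases "n = 0")
    case False
    then interpret R: real_distribution "\<mu> n" using dist by simp
    have "norm (r n) = real n * norm (z n - (1 + \<i> * of_real (t * m1 n) - of_real (t\<^sup>2 * m2 n / 2)))"
      by (simp add: r_def norm_mult)
    also have "\<dots> \<le> real n * (2 * measure (\<mu> n) {x. 1 \<le> \<bar>x\<bar>} + \<bar>t\<bar> ^ 3 * \<delta> * m2 n + t\<^sup>2 * measure (\<mu> n) {x. \<delta> \<le> \<bar>x\<bar>})"
      using R.char_truncated_expansion[OF that, of t] False
      by (intro mult_left_mono) (simp_all add: z_def m1_def m2_def)
    finally show ?thesis by (simp add: p_def algebra_simps)
  qed (simp add: r_def p_def)
  have "r \<longlonglongrightarrow> 0"
  proof (rule tendstoI)
    fix e :: real assume "e > 0"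
    \<comment> \<open>the remaining error tends to \<open>\<bar>t\<bar>\<^sup>3 \<delta> v\<close>, which this choice makes smaller than \<open>e\<close>\<close>
    define \<delta> where "\<delta> = e / (2 * (\<bar>t\<bar> ^ 3 * v + 1))"
    have pos: "\<bar>t\<bar> ^ 3 * v + 1 > 0" using \<open>v > 0\<close> by (simp add: add_nonneg_pos)
    then have "\<delta> > 0" using \<open>e > 0\<close> by (simp add: \<delta>_def)
    have lim: "(\<lambda>n. 2 * p 1 n + \<bar>t\<bar> ^ 3 * \<delta> * (real n * m2 n) + t\<^sup>2 * p \<delta> n) \<longlonglongrightarrow> 2 * 0 + \<bar>t\<bar> ^ 3 * \<delta> * v + t\<^sup>2 * 0"
      unfolding p_def m2_def by (intro tendsto_intros tail var \<open>\<delta> > 0\<close>) simp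
    have "2 * 0 + \<bar>t\<bar> ^ 3 * \<delta> * v + t\<^sup>2 * 0 \<le> \<delta> * (\<bar>t\<bar> ^ 3 * v + 1)"
      using \<open>\<delta> > 0\<close> by (simp add: algebra_simps)
    also have "\<dots> < e" using pos \<open>e > 0\<close> by (simp add: \<delta>_def divide_simps) (simp add: algebra_simps)
    finally have "\<forall>\<^sub>F n in sequentially. 2 * p 1 n + \<bar>t\<bar> ^ 3 * \<delta> * (real n * m2 n) + t\<^sup>2 * p \<delta> n < e"
      by (rule order_tendstoD(2)[OF lim])
    then show "\<forall>\<^sub>F n in sequentially. dist (r n) 0 < e"
      by eventually_elim (use r_le[OF \<open>\<delta> > 0\<close>] in \<open>auto intro: le_less_trans\<close>)
  qed
  then have "(\<lambda>n. r n + \<i> * of_real (t * (real n * m1 n)) - of_real (t\<^sup>2 * (real n * m2 n) / 2))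
      \<longlonglongrightarrow> 0 + \<i> * of_real (t * 0) - of_real (t\<^sup>2 * v / 2)"
    unfolding m1_def m2_def by (intro tendsto_intros mean var) simp_all
  moreover have "r n + \<i> * of_real (t * (real n * m1 n)) - of_real (t\<^sup>2 * (real n * m2 n) / 2)
      = of_nat n * (z n - 1)" for n
    by (simp add: r_def algebra_simps)
  ultimately have "(\<lambda>n. of_nat n * (z n - 1)) \<longlonglongrightarrow> of_real (- (t\<^sup>2 * v) / 2)" by simp
  from power_tendsto_exp[OF z1 _ this] \<open>v > 0\<close>
  show "(\<lambda>n. char (distr M borel (\<lambda>\<omega>. \<Sum>i=1..n. W n i \<omega>)) t) \<longlonglongrightarrow> char (centered_normal v) t"
    unfolding z_pow char_centered_normal[OF \<open>v > 0\<close>] by simp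
qed

text \<open>Slutsky's theorem for a normal limit and a remainder that vanishes in mean square: the
characteristic functions with and without \<open>Q\<close> differ by at most \<open>\<bar>t\<bar> E \<bar>Q\<bar>\<close>.\<close>

lemma (in prob_space) weak_conv_normal_affine_perturbation:
  fixes P Q :: "nat \<Rightarrow> 'a \<Rightarrow> real"
  assumes P[measurable]: "\<And>n. P n \<in> borel_measurable M" and Q[measurable]: "\<And>n. Q n \<in> borel_measurable M"
    and conv: "weak_conv_m (\<lambda>n. distr M borel (P n)) (centered_normal v)"
    and "v > 0" "c \<noteq> 0"
    and int: "\<And>n. integrable M (\<lambda>\<omega>. (Q n \<omega>)\<^sup>2)"
    and small: "(\<lambda>n. expectation (\<lambda>\<omega>. (Q n \<omega>)\<^sup>2)) \<longlonglongrightarrow> 0"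
  shows "weak_conv_m (\<lambda>n. distr M borel (\<lambda>\<omega>. c * P n \<omega> + Q n \<omega>)) (centered_normal (c\<^sup>2 * v))"
proof (rule levy_continuity)
  show "real_distribution (distr M borel (\<lambda>\<omega>. c * P n \<omega> + Q n \<omega>))" for n
    by (rule real_distribution_distr) simp
  show "real_distribution (centered_normal (c\<^sup>2 * v))"
    using assms by (intro real_distribution_centered_normal) simp
  fix t
  let ?A = "\<lambda>n. char (distr M borel (\<lambda>\<omega>. c * P n \<omega> + Q n \<omega>)) t"
  let ?B = "\<lambda>n. char (distr M borel (P n)) (t * c)"
  have "(\<lambda>n. ?B n) \<longlonglongrightarrow> char (centered_normal v) (t * c)"
    using assms by (intro levy_continuity1 real_distribution_distr real_distribution_centered_normal) auto
  also have "char (centered_normal v) (t * c) = char (centered_normal (c\<^sup>2 * v)) t"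
    using assms by (simp add: char_centered_normal power_mult_distrib mult_ac)
  finally have B: "?B \<longlonglongrightarrow> char (centered_normal (c\<^sup>2 * v)) t" .
  have bound: "norm (?A n - ?B n) \<le> \<bar>t\<bar> * sqrt (expectation (\<lambda>\<omega>. (Q n \<omega>)\<^sup>2))" for n
  proof -
    have intQ: "integrable M (Q n)"
      by (rule square_integrable_imp_integrable[OF _ int]) simp
    have A: "?A n = (\<integral>\<omega>. iexp (t * (c * P n \<omega> + Q n \<omega>)) \<partial>M)"
      unfolding char_def by (subst integral_distr) auto
    have B: "?B n = (\<integral>\<omega>. iexp (t * (c * P n \<omega>)) \<partial>M)"
      unfolding char_def by (subst integral_distr) (auto simp: mult_ac)
    have i1: "integrable M (\<lambda>\<omega>. iexp (t * (c * P n \<omega> + Q n \<omega>)))" "integrable M (\<lambda>\<omega>. iexp (t * (c * P n \<omega>)))"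
      by (rule integrable_const_bound[where B=1]; simp del: of_real_mult of_real_add)+
    have *: "norm (iexp (t * (c * P n \<omega> + Q n \<omega>)) - iexp (t * (c * P n \<omega>))) \<le> \<bar>t\<bar> * \<bar>Q n \<omega>\<bar>" for \<omega>
    proof -
      have "iexp (t * (c * P n \<omega> + Q n \<omega>)) - iexp (t * (c * P n \<omega>))
          = iexp (t * (c * P n \<omega>)) * (iexp (t * Q n \<omega>) - 1)"
        by (simp add: algebra_simps exp_add)
      then have "norm (iexp (t * (c * P n \<omega> + Q n \<omega>)) - iexp (t * (c * P n \<omega>))) = norm (iexp (t * Q n \<omega>) - 1)"
        by (simp add: norm_mult del: of_real_mult of_real_add)
      also have "\<dots> \<le> \<bar>t * Q n \<omega>\<bar>"
        using iexp_approx1[of "t * Q n \<omega>" 0] by simp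
      finally show ?thesis by (simp add: abs_mult)
    qed
    have "norm (?A n - ?B n) \<le> (\<integral>\<omega>. norm (iexp (t * (c * P n \<omega> + Q n \<omega>)) - iexp (t * (c * P n \<omega>))) \<partial>M)"
      unfolding A B by (subst Bochner_Integration.integral_diff[symmetric, OF i1]) (rule integral_norm_bound)
    also have "\<dots> \<le> (\<integral>\<omega>. \<bar>t\<bar> * \<bar>Q n \<omega>\<bar> \<partial>M)"
      using * i1 intQ
      by (intro integral_mono integrable_norm Bochner_Integration.integrable_diff integrable_mult_right integrable_abs) auto
    also have "\<dots> = \<bar>t\<bar> * expectation (\<lambda>\<omega>. \<bar>Q n \<omega>\<bar>)" by simp
    also have "(expectation (\<lambda>\<omega>. \<bar>Q n \<omega>\<bar>))\<^sup>2 \<le> expectation (\<lambda>\<omega>. (Q n \<omega>)\<^sup>2)"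
      using variance_positive[of "\<lambda>\<omega>. \<bar>Q n \<omega>\<bar>"] intQ int by (subst (asm) variance_eq) auto
    then have "expectation (\<lambda>\<omega>. \<bar>Q n \<omega>\<bar>) \<le> sqrt (expectation (\<lambda>\<omega>. (Q n \<omega>)\<^sup>2))"
      by (rule real_le_rsqrt)
    then have "\<bar>t\<bar> * expectation (\<lambda>\<omega>. \<bar>Q n \<omega>\<bar>) \<le> \<bar>t\<bar> * sqrt (expectation (\<lambda>\<omega>. (Q n \<omega>)\<^sup>2))"
      by (rule mult_left_mono) simp
    finally show ?thesis .
  qed
  have lim: "(\<lambda>n. \<bar>t\<bar> * sqrt (expectation (\<lambda>\<omega>. (Q n \<omega>)\<^sup>2))) \<longlonglongrightarrow> 0"
    using tendsto_mult[OF tendsto_const tendsto_real_sqrt[OF small]] by simp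
  have "(\<lambda>n. ?A n - ?B n) \<longlonglongrightarrow> 0"
    by (rule Lim_null_comparison[OF always_eventually lim]) (use bound in blast)
  from tendsto_add[OF this B] show "?A \<longlonglongrightarrow> char (centered_normal (c\<^sup>2 * v)) t" by simp
qed

section \<open>The Abel transform\<close>

text \<open>The antiderivative \<open>2 arcsin (sqrt ((u - b) / (y - b)))\<close> serves two cases: \<open>b = a\<close> gives the constant
value \<open>\<pi>\<close>, which expresses \<open>V_model\<close> through \<open>\<rho>\<close>, and \<open>b = 0\<close> gives the angle that arises when
\<open>V_of\<close> is integrated against \<open>du / (2 sqrt u)\<close>.\<close>

lemma abel_kernel_integral:
  fixes a b y :: real
  assumes "b \<le> a" "a < y"
  shows "has_bochner_integral lborel (\<lambda>u. indicator {a<..<y} u / (sqrt (u - b) * sqrt (y - u)))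
    (pi - 2 * arcsin (sqrt ((a - b) / (y - b))))"
proof -
  define F where "F u = 2 * arcsin (sqrt ((u - b) / (y - b)))" for u
  let ?f = "\<lambda>u. 1 / (sqrt (u - b) * sqrt (y - u))"
  have cont: "continuous_on {a..y} F"
    unfolding F_def using assms
    by (intro continuous_intros) (auto simp: field_simps order_trans[of "-1" 0])
  have lim_a: "(F \<longlongrightarrow> F a) (at_right a)"
    using cont assms by (auto simp: continuous_on_Icc_at_rightD)
  have lim_y: "(F \<longlongrightarrow> pi) (at_left y)"
    using continuous_on_Icc_at_leftD[OF cont \<open>a < y\<close>] assms by (simp add: F_def)
  have deriv: "DERIV F u :> ?f u" if "a < u" "u < y" for u
  proof -
    have u: "0 < u - b" "0 < y - u" "0 < y - b" using that assms by auto
    have r: "0 < (u - b) / (y - b)" "(u - b) / (y - b) < 1" using u by (auto simp: field_simps)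
    have s: "- 1 < sqrt ((u - b) / (y - b))" "sqrt ((u - b) / (y - b)) < 1"
      subgoal using real_sqrt_gt_zero[OF r(1)] by linarith
      subgoal using r(2) by (simp only: real_sqrt_lt_1_iff)
      done
    have "DERIV F u :> 2 * (inverse (sqrt (1 - (sqrt ((u - b) / (y - b)))\<^sup>2)) *
        (inverse (sqrt ((u - b) / (y - b))) / 2 * (1 / (y - b))))"
      unfolding F_def using r u s by (auto intro!: derivative_eq_intros simp: divide_less_0_iff)
    moreover have "1 - (sqrt ((u - b) / (y - b)))\<^sup>2 = (y - u) / (y - b)"
      using r u by (simp add: field_simps)
    moreover have "2 * (inverse (sqrt ((y - u) / (y - b))) * (inverse (sqrt ((u - b) / (y - b))) / 2 * (1 / (y - b)))) = ?f u"
      using u by (simp add: real_sqrt_divide field_simps)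
    ultimately show ?thesis by simp
  qed
  have isCont: "isCont ?f u" if "a < u" "u < y" for u
    using that assms by (intro continuous_intros) auto
  have *: "set_integrable lborel (einterval (ereal a) (ereal y)) ?f"
    "(LBINT u=ereal a..ereal y. ?f u) = pi - F a"
  proof -
    have le: "ereal a < ereal y" using assms by simp
    have "AE u in lborel. ereal a < ereal u \<longrightarrow> ereal u < ereal y \<longrightarrow> 0 \<le> ?f u"
      using assms by (intro AE_I2) auto
    note FTC = interval_integral_FTC_nonneg[where F = F and f = ?f, OF le _ _ this]
    show "set_integrable lborel (einterval (ereal a) (ereal y)) ?f"
      by (rule FTC(1)) (use deriv isCont lim_a lim_y in \<open>auto simp: ereal_tendsto_simps1\<close>)
    show "(LBINT u=ereal a..ereal y. ?f u) = pi - F a"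
      by (rule FTC(2)) (use deriv isCont lim_a lim_y in \<open>auto simp: ereal_tendsto_simps1\<close>)
  qed
  have eq: "indicator {a<..<y} u / (sqrt (u - b) * sqrt (y - u)) = indicator {a<..<y} u *\<^sub>R ?f u" for u
    by simp
  show ?thesis
    unfolding has_bochner_integral_iff eq using * assms
    by (simp add: set_integrable_def interval_lebesgue_integral_def set_lebesgue_integral_def F_def)
qed

lemma abel_kernel_nonneg:
  fixes a b y :: real
  assumes "b \<le> a" "a < y"
  shows "0 \<le> pi - 2 * arcsin (sqrt ((a - b) / (y - b)))"
proof -
  have "arcsin (sqrt ((a - b) / (y - b))) \<le> pi / 2"
    using assms by (intro arcsin_ubound) (auto simp: field_simps order_trans[of "-1" 0])
  then show ?thesis by simp
qed

text \<open>Tonelli's theorem.  The inner integral may diverge for some \<open>u\<close>, where it has the value \<open>0\<close>; the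
finiteness of the double integral confines this to a null set.\<close>

lemma abel_transform_integral:
  fixes \<mu> :: "real measure" and w :: "real \<Rightarrow> real" and a b :: real
  assumes [measurable_cong]: "sets \<mu> = sets borel" and "sigma_finite_measure \<mu>"
    and w[measurable]: "w \<in> borel_measurable borel" and w0: "\<And>y. 0 \<le> w y"
    and int: "integrable \<mu> (\<lambda>y. indicator {a<..} y * w y)" and "b \<le> a"
  shows "set_integrable lborel {a<..} (\<lambda>u. (LINT y:{u<..}|\<mu>. w y / sqrt (y - u)) / sqrt (u - b))"
    and "(LINT u:{a<..}|lborel. (LINT y:{u<..}|\<mu>. w y / sqrt (y - u)) / sqrt (u - b))
      = (\<integral>y. indicator {a<..} y * w y * (pi - 2 * arcsin (sqrt ((a - b) / (y - b)))) \<partial>\<mu>)"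
proof -
  interpret \<mu>: sigma_finite_measure \<mu> by fact
  interpret pair_sigma_finite \<mu> lborel by unfold_locales
  let ?c = "\<lambda>y. pi - 2 * arcsin (sqrt ((a - b) / (y - b)))"
  define k where "k y u = w y * (indicator {a<..} u * ((if u < y then 1 else 0) / (sqrt (u - b) * sqrt (y - u))))"
    for y u :: real
  have k_eq: "k y u = indicator {a<..} y * w y * (indicator {a<..<y} u / (sqrt (u - b) * sqrt (y - u)))" for y u
    by (auto simp: k_def indicator_def)
  have k_has: "has_bochner_integral lborel (k y) (indicator {a<..} y * w y * ?c y)" for y
  proof (cases "a < y")
    case True
    then show ?thesis unfolding k_eq[abs_def]
      by (intro has_bochner_integral_mult_right abel_kernel_integral \<open>b \<le> a\<close>)
  qed (simp add: k_eq[abs_def] has_bochner_integral_zero)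
  have k0: "0 \<le> k y u" if "b \<le> u" for y u using w0 that by (auto simp: k_def indicator_def)
  have k_norm: "norm (k y u) = k y u" for y u
  proof (cases "b \<le> u")
    case True
    then show ?thesis using k0[of u y] by simp
  next
    case False
    then show ?thesis using \<open>b \<le> a\<close> by (simp add: k_def)
  qed
  have k_meas[measurable]: "(\<lambda>(y, u). k y u) \<in> borel_measurable (\<mu> \<Otimes>\<^sub>M lborel)"
  proof -
    have "(\<lambda>(y, u). k y u) \<in> borel_measurable (borel \<Otimes>\<^sub>M borel)"
      unfolding k_def[abs_def] by measurable
    moreover have "sets (\<mu> \<Otimes>\<^sub>M lborel) = sets (borel \<Otimes>\<^sub>M borel)"
      using assms(1) by (intro sets_pair_measure_cong) auto
    ultimately show ?thesis by (simp cong: measurable_cong_sets)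
  qed
  have int_c: "integrable \<mu> (\<lambda>y. indicator {a<..} y * w y * ?c y)"
  proof (rule Bochner_Integration.integrable_bound)
    show "integrable \<mu> (\<lambda>y. pi * (indicator {a<..} y * w y))" using int by (rule integrable_mult_right)
    have "\<bar>?c y\<bar> \<le> pi" if "a < y" for y
    proof -
      have "0 \<le> arcsin (sqrt ((a - b) / (y - b)))"
        using that \<open>b \<le> a\<close> by (intro arcsin_nonneg) (auto simp: field_simps)
      then show ?thesis using abel_kernel_nonneg[OF \<open>b \<le> a\<close> that] by auto
    qed
    then show "AE y in \<mu>. norm (indicator {a<..} y * w y * ?c y) \<le> norm (pi * (indicator {a<..} y * w y))"
      by (intro AE_I2) (auto simp: indicator_def abs_mult w0 mult.commute[of pi] intro!: mult_left_mono)
    have "(\<lambda>y. \<integral>u. k y u \<partial>lborel) \<in> borel_measurable \<mu>" by measurable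
    then show "(\<lambda>y. indicator {a<..} y * w y * ?c y) \<in> borel_measurable \<mu>"
      by (simp only: has_bochner_integral_integral_eq[OF k_has])
  qed
  have k_int: "integrable (\<mu> \<Otimes>\<^sub>M lborel) (\<lambda>(y, u). k y u)"
  proof (rule Fubini_integrable)
    show "integrable \<mu> (\<lambda>y. \<integral>u. norm (case (y, u) of (y, u) \<Rightarrow> k y u) \<partial>lborel)"
      using int_c by (simp only: prod.case k_norm has_bochner_integral_integral_eq[OF k_has])
    show "AE y in \<mu>. integrable lborel (\<lambda>u. case (y, u) of (y, u) \<Rightarrow> k y u)"
      using k_has by (auto simp: has_bochner_integral_iff)
  qed (rule k_meas)
  have inner: "(\<integral>y. k y u \<partial>\<mu>) = indicator {a<..} u *\<^sub>R ((LINT y:{u<..}|\<mu>. w y / sqrt (y - u)) / sqrt (u - b))" for u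
    unfolding k_def set_lebesgue_integral_def
    by (subst Bochner_Integration.integral_divide_zero[symmetric], cases "a < u")
      (auto intro!: Bochner_Integration.integral_cong simp: mult_ac)
  show "set_integrable lborel {a<..} (\<lambda>u. (LINT y:{u<..}|\<mu>. w y / sqrt (y - u)) / sqrt (u - b))"
    using integrable_snd[OF k_int] unfolding inner set_integrable_def .
  show "(LINT u:{a<..}|lborel. (LINT y:{u<..}|\<mu>. w y / sqrt (y - u)) / sqrt (u - b))
      = (\<integral>y. indicator {a<..} y * w y * (pi - 2 * arcsin (sqrt ((a - b) / (y - b)))) \<partial>\<mu>)"
    unfolding set_lebesgue_integral_def[of lborel] inner[symmetric] Fubini_integral[OF k_int]
    by (simp only: has_bochner_integral_integral_eq[OF k_has])
qed

text \<open>Taking the maximum with \<open>x\<close> makes the function vanish for \<open>y \<le> x\<close> and keeps it continuous.\<close>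

definition tail_angle :: "real \<Rightarrow> real \<Rightarrow> real" where
  "tail_angle x y = arccos (sqrt (x / max x y))"

lemma tail_angle_eq:
  assumes "x > 0"
  shows "tail_angle x y = indicator {x<..} y * (pi / 2 - arcsin (sqrt (x / y)))"
proof (cases "x < y")
  case True
  then show ?thesis using assms
    by (simp add: tail_angle_def arccos_arcsin_eq field_simps order_trans[of "-1" 0])
next
  case False
  then show ?thesis using assms by (simp add: tail_angle_def max_def)
qed

lemma tail_angle_bounds:
  assumes "x > 0"
  shows "0 \<le> tail_angle x y" "tail_angle x y \<le> pi / 2"
proof -
  have "0 \<le> sqrt (x / max x y)" "sqrt (x / max x y) \<le> 1"
    using assms by auto
  then show "0 \<le> tail_angle x y" "tail_angle x y \<le> pi / 2"
    using arccos_lbound[of "sqrt (x / max x y)"] arccos_le_pi2[of "sqrt (x / max x y)"]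
    unfolding tail_angle_def by linarith+
qed

lemma continuous_on_tail_angle: "x > 0 \<Longrightarrow> continuous_on UNIV (tail_angle x)"
  unfolding tail_angle_def
  by (intro continuous_intros ballI conjI) (auto simp: max_def order_trans[of "-1" 0])

lemma tail_angle_measurable: "x > 0 \<Longrightarrow> tail_angle x \<in> borel_measurable borel"
  by (rule borel_measurable_continuous_onI[OF continuous_on_tail_angle])

definition inv_sqrt_excess :: "real \<Rightarrow> real \<Rightarrow> real" where
  "inv_sqrt_excess x y = indicator {x<..} y / sqrt (y - x)"

lemma inv_sqrt_excess_measurable[measurable]: "inv_sqrt_excess x \<in> borel_measurable borel"
  unfolding inv_sqrt_excess_def by measurable

lemma inv_sqrt_excess_nonneg: "0 \<le> inv_sqrt_excess x y"
  by (auto simp: inv_sqrt_excess_def indicator_def)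

lemma V_of_eq: "V_of H x = (\<integral>y. inv_sqrt_excess x y \<partial>interval_measure H)"
  by (simp add: V_of_def inv_sqrt_excess_def set_lebesgue_integral_def)

lemma V_emp_eq: "V_emp n y x = (\<Sum>i=1..n. inv_sqrt_excess x (y i)) / real n"
proof -
  have "(\<Sum>i | i \<in> {1..n} \<and> y i > x. 1 / sqrt (y i - x)) = (\<Sum>i=1..n. inv_sqrt_excess x (y i))"
    by (rule sum.mono_neutral_cong_left) (auto simp: inv_sqrt_excess_def)
  then show ?thesis by (simp add: V_emp_def)
qed

lemma inv_sqrt_excess_integral:
  assumes "x > 0"
  shows "has_bochner_integral lborel
    (\<lambda>u. indicator {x<..} u *\<^sub>R (inv_sqrt_excess u y / (2 * sqrt u))) (tail_angle x y)"
proof (cases "x < y")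
  case True
  have "has_bochner_integral lborel (\<lambda>u. (indicator {x<..<y} u / (sqrt (u - 0) * sqrt (y - u))) / 2)
     ((pi - 2 * arcsin (sqrt ((x - 0) / (y - 0)))) / 2)"
    using assms True by (intro has_bochner_integral_divide_zero abel_kernel_integral) auto
  moreover have "(pi - 2 * arcsin (sqrt ((x - 0) / (y - 0)))) / 2 = tail_angle x y"
    using assms True by (simp add: tail_angle_eq)
  moreover have "(indicator {x<..<y} u / (sqrt (u - 0) * sqrt (y - u))) / 2
      = indicator {x<..} u *\<^sub>R (inv_sqrt_excess u y / (2 * sqrt u))" for u
    by (auto simp: inv_sqrt_excess_def indicator_def)
  ultimately show ?thesis by simp
next
  case False
  then have "indicator {x<..} u *\<^sub>R (inv_sqrt_excess u y / (2 * sqrt u)) = 0" for u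
    by (auto simp: inv_sqrt_excess_def indicator_def)
  then show ?thesis using False assms
    by (simp only: tail_angle_eq) (simp add: has_bochner_integral_zero)
qed

lemma V_emp_integral:
  assumes "x > 0"
  shows "set_integrable lborel {x<..} (\<lambda>u. V_emp n y u / (2 * sqrt u))"
    and "(LINT u:{x<..}|lborel. V_emp n y u / (2 * sqrt u)) = (\<Sum>i=1..n. tail_angle x (y i)) / real n"
proof -
  have "has_bochner_integral lborel
      (\<lambda>u. (\<Sum>i=1..n. indicator {x<..} u *\<^sub>R (inv_sqrt_excess u (y i) / (2 * sqrt u))) / real n)
      ((\<Sum>i=1..n. tail_angle x (y i)) / real n)"
    by (intro has_bochner_integral_divide_zero has_bochner_integral_sum inv_sqrt_excess_integral assms)
  moreover have "(\<Sum>i=1..n. indicator {x<..} u *\<^sub>R (inv_sqrt_excess u (y i) / (2 * sqrt u))) / real n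
      = indicator {x<..} u *\<^sub>R (V_emp n y u / (2 * sqrt u))" for u
    by (simp add: V_emp_eq sum_distrib_left sum_divide_distrib mult_ac)
  ultimately have "has_bochner_integral lborel
      (\<lambda>u. indicator {x<..} u *\<^sub>R (V_emp n y u / (2 * sqrt u))) ((\<Sum>i=1..n. tail_angle x (y i)) / real n)"
    by (simp only:)
  then show "set_integrable lborel {x<..} (\<lambda>u. V_emp n y u / (2 * sqrt u))"
    "(LINT u:{x<..}|lborel. V_emp n y u / (2 * sqrt u)) = (\<Sum>i=1..n. tail_angle x (y i)) / real n"
    unfolding set_integrable_def set_lebesgue_integral_def by (auto simp: has_bochner_integral_iff)
qed

lemma V_of_integral:
  assumes "x > 0" "real_distribution (interval_measure H)"
  shows "set_integrable lborel {x<..} (\<lambda>u. V_of H u / (2 * sqrt u))"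
    and "(LINT u:{x<..}|lborel. V_of H u / (2 * sqrt u)) = (\<integral>y. tail_angle x y \<partial>interval_measure H)"
proof -
  interpret real_distribution "interval_measure H" by fact
  have "integrable (interval_measure H) (\<lambda>y. indicator {x<..} y * 1 :: real)"
    by (rule integrable_const_bound[where B=1]) (auto simp: indicator_def)
  note abel = abel_transform_integral[where w = "\<lambda>_. 1" and b = 0,
      OF _ sigma_finite_measure_axioms _ _ this, folded V_of_def]
  have *: "set_integrable lborel {x<..} (\<lambda>u. V_of H u / sqrt (u - 0))"
    by (rule abel(1)) (use \<open>x > 0\<close> in simp_all)
  have **: "(LINT u:{x<..}|lborel. V_of H u / sqrt (u - 0))
      = (\<integral>y. indicator {x<..} y * 1 * (pi - 2 * arcsin (sqrt ((x - 0) / (y - 0)))) \<partial>interval_measure H)"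
    by (rule abel(2)) (use \<open>x > 0\<close> in simp_all)
  have eq: "V_of H u / (2 * sqrt u) = (V_of H u / sqrt u) / 2" for u by simp
  show "set_integrable lborel {x<..} (\<lambda>u. V_of H u / (2 * sqrt u))"
    unfolding eq using * by (intro set_integrable_divide) simp
  have "(LINT u:{x<..}|lborel. V_of H u / (2 * sqrt u)) = (LINT u:{x<..}|lborel. V_of H u / sqrt u) / 2"
    unfolding eq by (rule set_integral_divide_zero)
  also have "\<dots> = (\<integral>y. indicator {x<..} y * (pi - 2 * arcsin (sqrt (x / y))) / 2 \<partial>interval_measure H)"
    using ** by simp
  also have "\<dots> = (\<integral>y. tail_angle x y \<partial>interval_measure H)"
    by (rule Bochner_Integration.integral_cong) (auto simp: tail_angle_eq[OF assms(1)] field_simps)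
  finally show "(LINT u:{x<..}|lborel. V_of H u / (2 * sqrt u)) = (\<integral>y. tail_angle x y \<partial>interval_measure H)" .
qed

section \<open>The spherically symmetric model\<close>

lemma power2_norm_vec3:
  fixes x :: "real ^ 3"
  shows "(norm x)\<^sup>2 = (x $ 1)\<^sup>2 + (x $ 2)\<^sup>2 + (x $ 3)\<^sup>2"
  unfolding power2_norm_eq_inner by (simp add: inner_vec_def sum_3 power2_eq_square)

text \<open>The derivative at \<open>0\<close> is treated separately since the square root is not differentiable there; as it is
extended to negative arguments as an odd function, its cube has a two-sided derivative.\<close>

lemma nn_integral_sqrt:
  assumes "0 \<le> a"
  shows "(\<integral>\<^sup>+z. ennreal (2 * pi * sqrt z) * indicator {0..a} z \<partial>lborel) = ennreal (4 / 3 * pi * sqrt a ^ 3)"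
proof -
  define F where "F z = 4 / 3 * pi * sqrt z ^ 3" for z
  have "DERIV F z :> 2 * pi * sqrt z" if "0 < z" for z
    unfolding F_def using that
    by (auto intro!: derivative_eq_intros simp: field_simps power2_eq_square)
  moreover have "DERIV F 0 :> 2 * pi * sqrt 0"
  proof -
    have lim: "((\<lambda>z. 4 / 3 * pi * \<bar>sqrt z\<bar>) \<longlongrightarrow> 4 / 3 * pi * \<bar>sqrt 0\<bar>) (at 0)"
      by (intro tendsto_intros)
    have ev: "\<forall>\<^sub>F z in at 0. 4 / 3 * pi * \<bar>sqrt z\<bar> = (F z - F 0) / (z - 0)"
    proof (rule eventually_at_filter[THEN iffD2], intro always_eventually allI impI)
      fix z :: real assume "z \<noteq> 0"
      have "sqrt z ^ 3 = sqrt z * \<bar>z\<bar>" by (simp add: power3_eq_cube mult.assoc)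
      also have "\<dots> = \<bar>sqrt z\<bar> * z" by (simp add: abs_if)
      finally show "4 / 3 * pi * \<bar>sqrt z\<bar> = (F z - F 0) / (z - 0)"
        using \<open>z \<noteq> 0\<close> by (simp add: F_def)
    qed
    have "((\<lambda>z. (F z - F 0) / (z - 0)) \<longlongrightarrow> 4 / 3 * pi * \<bar>sqrt 0\<bar>) (at 0)"
      by (rule tendsto_cong[OF ev, THEN iffD1, OF lim])
    then show ?thesis by (simp add: has_field_derivative_iff)
  qed
  ultimately have "DERIV F z :> 2 * pi * sqrt z" if "0 \<le> z" for z
    using that by (cases "z = 0") auto
  then have "(\<integral>\<^sup>+z. ennreal (2 * pi * sqrt z) * indicator {0..a} z \<partial>lborel) = F a - F 0"
    using assms by (intro nn_integral_FTC_Icc) auto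
  then show ?thesis by (simp add: F_def)
qed

text \<open>Polar coordinates in the form needed here.  The two measures agree on half-lines by the formula for
the volume of a ball.\<close>

lemma distr_power2_norm_vec3:
  "distr (lborel :: (real ^ 3) measure) borel (\<lambda>x. (norm x)\<^sup>2)
     = density lborel (\<lambda>z. ennreal (2 * pi * sqrt z) * indicator {0..} z)"
proof (rule measure_eqI_generator_eq)
  let ?E = "range (\<lambda>a::real. {..a})"
  have le_iff: "(norm x)\<^sup>2 \<le> a \<longleftrightarrow> x \<in> cball 0 (sqrt a)" if "0 \<le> a" for a and x :: "real ^ 3"
    using that power_mono[of "norm x" "sqrt a" 2] by (auto intro: real_le_rsqrt)
  have L: "emeasure (distr (lborel :: (real ^ 3) measure) borel (\<lambda>x. (norm x)\<^sup>2)) {..a}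
      = (if 0 \<le> a then ennreal (4 / 3 * pi * sqrt a ^ 3) else 0)" for a
  proof -
    have "(\<lambda>x::real^3. (norm x)\<^sup>2) -` {..a} = (if 0 \<le> a then cball 0 (sqrt a) else {})"
      using le_iff[of a] order_trans[OF zero_le_power2, of _ a] by (auto simp: vimage_def)
    then show ?thesis
      by (simp add: emeasure_distr emeasure_cball unit_ball_vol_3)
  qed
  show "Int_stable ?E" by (auto simp: Int_stable_def)
  show "emeasure (distr (lborel :: (real ^ 3) measure) borel (\<lambda>x. (norm x)\<^sup>2)) X
      = emeasure (density lborel (\<lambda>z. ennreal (2 * pi * sqrt z) * indicator {0..} z)) X" if "X \<in> ?E" for X
  proof -
    from that obtain a where X: "X = {..a}" by (rule rangeE)
    have "emeasure (density lborel (\<lambda>z. ennreal (2 * pi * sqrt z) * indicator {0..} z)) {..a}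
        = (\<integral>\<^sup>+z. ennreal (2 * pi * sqrt z) * indicator {0..a} z \<partial>lborel)"
      by (subst emeasure_density) (auto intro!: nn_integral_cong simp: indicator_def)
    also have "\<dots> = (if 0 \<le> a then ennreal (4 / 3 * pi * sqrt a ^ 3) else 0)"
      by (simp add: nn_integral_sqrt)
    finally show ?thesis by (simp only: X L)
  qed
  show "range (\<lambda>n::nat. {..real n}) \<subseteq> ?E" by auto
  show "(\<Union>n::nat. {..real n}) = (UNIV :: real set)" by (auto intro: real_arch_simple)
  show "emeasure (distr (lborel :: (real ^ 3) measure) borel (\<lambda>x. (norm x)\<^sup>2)) {..real n} \<noteq> \<infinity>" for n
    unfolding L by simp
qed (auto simp: borel_eq_atMost[where 'a=real])

lemma nn_integral_radial_vec3:
  assumes [measurable]: "h \<in> borel_measurable borel"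
  shows "(\<integral>\<^sup>+x. h ((norm x)\<^sup>2) \<partial>(lborel :: (real ^ 3) measure))
     = (\<integral>\<^sup>+z. ennreal (2 * pi * sqrt z) * indicator {0..} z * h z \<partial>lborel)"
proof -
  have "(\<integral>\<^sup>+x. h ((norm x)\<^sup>2) \<partial>(lborel :: (real ^ 3) measure))
      = (\<integral>\<^sup>+z. h z \<partial>distr (lborel :: (real ^ 3) measure) borel (\<lambda>x. (norm x)\<^sup>2))"
    by (simp add: nn_integral_distr)
  then show ?thesis unfolding distr_power2_norm_vec3 by (simp add: nn_integral_density)
qed

text \<open>Each ray from the origin meets the cylinder in at most one point when \<open>c \<noteq> 0\<close>; for \<open>c = 0\<close> the set is
a line.\<close>

lemma negligible_cylinder_vec3: "negligible {x :: real ^ 3. (x $ 1)\<^sup>2 + (x $ 2)\<^sup>2 = c}"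
proof (cases "c = 0")
  case True
  have "negligible {x :: real ^ 3. x $ 1 = 0}" by (rule negligible_standard_hyperplane_cart)
  then show ?thesis by (rule negligible_subset) (auto simp: True)
next
  case False
  show ?thesis
  proof (rule starlike_negligible[where a = 0])
    show "closed {x :: real ^ 3. (x $ 1)\<^sup>2 + (x $ 2)\<^sup>2 = c}"
      by (intro closed_Collect_eq continuous_intros)
    fix r :: real and x :: "real ^ 3"
    assume "0 + r *\<^sub>R x \<in> {x. (x $ 1)\<^sup>2 + (x $ 2)\<^sup>2 = c}" "0 \<le> r" "0 + x \<in> {x. (x $ 1)\<^sup>2 + (x $ 2)\<^sup>2 = c}"
    then have "r\<^sup>2 * c = c" "0 \<le> r" by (auto simp: power_mult_distrib distrib_left[symmetric])
    then show "r = 1" using False by (simp add: power2_eq_1_iff)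
  qed
qed

definition rotation_13 :: "real \<Rightarrow> real ^ 3 \<Rightarrow> real ^ 3" where
  "rotation_13 t x = vector [cos t * x $ 1 + sin t * x $ 3, x $ 2, cos t * x $ 3 - sin t * x $ 1]"

lemma linear_rotation_13: "linear (rotation_13 t)"
  by (rule linearI) (auto simp: rotation_13_def vec_eq_iff forall_3 algebra_simps)

lemma norm_rotation_13: "(norm (rotation_13 t x))\<^sup>2 = (norm x)\<^sup>2"
proof -
  have "(norm (rotation_13 t x))\<^sup>2 = ((cos t)\<^sup>2 + (sin t)\<^sup>2) * ((x $ 1)\<^sup>2 + (x $ 3)\<^sup>2) + (x $ 2)\<^sup>2"
    unfolding power2_norm_vec3 rotation_13_def vector_3 by algebra
  then show ?thesis by (simp add: power2_norm_vec3)
qed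

lemma rotation_13_inverse: "rotation_13 (- t) (rotation_13 t x) = x"
proof -
  have "cos t * (cos t * x $ 1 + sin t * x $ 3) - sin t * (cos t * x $ 3 - sin t * x $ 1)
      = ((cos t)\<^sup>2 + (sin t)\<^sup>2) * x $ 1"
    "cos t * (cos t * x $ 3 - sin t * x $ 1) + sin t * (cos t * x $ 1 + sin t * x $ 3)
      = ((cos t)\<^sup>2 + (sin t)\<^sup>2) * x $ 3"
    by algebra+
  then show ?thesis by (simp add: rotation_13_def vec_eq_iff forall_3)
qed

text \<open>Some rotation about the second axis annihilates the third coordinate and thereby moves the whole norm
of \<open>x\<close> into the first two; nearby angles still satisfy the strict inequality, and some of them are
rational.\<close>

lemma rational_rotation_into_cylinder_complement:
  fixes x :: "real ^ 3"
  assumes "r < (norm x)\<^sup>2"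
  obtains q where "q \<in> \<rat>" "r < (rotation_13 q x $ 1)\<^sup>2 + (rotation_13 q x $ 2)\<^sup>2"
proof -
  define s where "s = sqrt ((x $ 1)\<^sup>2 + (x $ 3)\<^sup>2)"
  define g where "g t = (rotation_13 t x $ 1)\<^sup>2 + (rotation_13 t x $ 2)\<^sup>2" for t
  have s2: "s\<^sup>2 = (x $ 1)\<^sup>2 + (x $ 3)\<^sup>2" by (simp add: s_def)
  obtain t where t: "x $ 1 = s * cos t" "x $ 3 = s * sin t"
  proof (cases "s = 0")
    case True
    then have "x $ 1 = 0" "x $ 3 = 0" using s2 by (auto simp: sum_power2_eq_zero_iff)
    then show ?thesis using that[of 0] True by simp
  next
    case False
    then have "(x $ 1 / s)\<^sup>2 + (x $ 3 / s)\<^sup>2 = 1"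
      by (simp add: power_divide add_divide_distrib[symmetric] s2[symmetric])
    then obtain t where "x $ 1 / s = cos t" "x $ 3 / s = sin t"
      by (rule sincos_total_2pi)
    then show ?thesis using that[of t] False by (simp add: field_simps)
  qed
  have "g t = (s * ((cos t)\<^sup>2 + (sin t)\<^sup>2))\<^sup>2 + (x $ 2)\<^sup>2"
    unfolding g_def rotation_13_def vector_3 t by algebra
  then have "r < g t" using assms by (simp add: power2_norm_vec3 s2)
  moreover have "isCont g t" unfolding g_def rotation_13_def vector_3 by (intro continuous_intros)
  ultimately have "\<forall>\<^sub>F u in at t. r < g u" by (intro order_tendstoD(1)) (simp_all add: isCont_def)
  then obtain d where "d > 0" and d: "\<And>u. u \<noteq> t \<Longrightarrow> dist u t < d \<Longrightarrow> r < g u"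
    by (auto simp: eventually_at)
  obtain q where "q \<in> \<rat>" "t < q" "q < t + d"
    using Rats_dense_in_real[of t "t + d"] \<open>d > 0\<close> by auto
  then have "r < g q" by (intro d) (auto simp: dist_real_def)
  with \<open>q \<in> \<rat>\<close> show ?thesis by (intro that) (auto simp: g_def)
qed

text \<open>The exceptional set of the hypothesis, rotated by all rational angles, covers the exceptional set of
the conclusion, and a countable union of null sets is null.\<close>

lemma radial_property_off_cylinder_imp_off_ball:
  fixes P :: "real \<Rightarrow> bool" and r :: real
  assumes "AE x in (lborel :: (real ^ 3) measure). r < (x $ 1)\<^sup>2 + (x $ 2)\<^sup>2 \<longrightarrow> P ((norm x)\<^sup>2)"
  shows "AE x in (lborel :: (real ^ 3) measure). r < (norm x)\<^sup>2 \<longrightarrow> P ((norm x)\<^sup>2)"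
proof -
  define E where "E = {x :: real ^ 3. r < (x $ 1)\<^sup>2 + (x $ 2)\<^sup>2 \<and> \<not> P ((norm x)\<^sup>2)}"
  have "AE x in (lebesgue :: (real ^ 3) measure). r < (x $ 1)\<^sup>2 + (x $ 2)\<^sup>2 \<longrightarrow> P ((norm x)\<^sup>2)"
    using assms by (rule AE_completion)
  then obtain N where N: "negligible N" "{x :: real ^ 3. \<not> (r < (x $ 1)\<^sup>2 + (x $ 2)\<^sup>2 \<longrightarrow> P ((norm x)\<^sup>2))} \<subseteq> N"
    by (auto simp: eventually_ae_filter_negligible)
  have "E \<subseteq> N" using N(2) by (auto simp: E_def)
  then have E: "negligible E" by (rule negligible_subset[OF N(1)])
  have rot: "negligible (rotation_13 t ` E)" for t
    by (intro negligible_differentiable_image_negligible E order_refl linear_imp_differentiable_on linear_rotation_13)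
  have "(\<Union>q\<in>\<rat>. rotation_13 (- q) ` E) \<in> null_sets lebesgue"
    using rot by (intro null_sets_UN' countable_rat) (simp add: negligible_iff_null_sets)
  then have null: "negligible (\<Union>q\<in>\<rat>. rotation_13 (- q) ` E)"
    by (simp only: negligible_iff_null_sets)
  have sub: "{x :: real ^ 3. \<not> (r < (norm x)\<^sup>2 \<longrightarrow> P ((norm x)\<^sup>2))} \<subseteq> (\<Union>q\<in>\<rat>. rotation_13 (- q) ` E)"
  proof
    fix x :: "real ^ 3" assume "x \<in> {x :: real ^ 3. \<not> (r < (norm x)\<^sup>2 \<longrightarrow> P ((norm x)\<^sup>2))}"
    then have x: "r < (norm x)\<^sup>2" "\<not> P ((norm x)\<^sup>2)" by auto
    obtain q where q: "q \<in> \<rat>" "r < (rotation_13 q x $ 1)\<^sup>2 + (rotation_13 q x $ 2)\<^sup>2"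
      using rational_rotation_into_cylinder_complement[OF x(1)] .
    then have "rotation_13 q x \<in> E" using x by (simp add: E_def norm_rotation_13)
    then have "x \<in> rotation_13 (- q) ` E" by (metis imageI rotation_13_inverse)
    with q show "x \<in> (\<Union>q\<in>\<rat>. rotation_13 (- q) ` E)" by blast
  qed
  have "AE x in (lebesgue :: (real ^ 3) measure). r < (norm x)\<^sup>2 \<longrightarrow> P ((norm x)\<^sup>2)"
    by (rule eventually_ae_filter_negligible[THEN iffD2]) (intro exI conjI, rule null, rule sub)
  then show ?thesis by (simp add: AE_completion_iff)
qed

locale spherical_model = prob_space N
  for N :: "'b measure" +
  fixes X :: "'b \<Rightarrow> real ^ 3" and \<rho> :: "real \<Rightarrow> real" and x\<^sub>0 :: real
  assumes rho_nonneg: "\<And>z. z \<ge> 0 \<Longrightarrow> \<rho> z \<ge> 0"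
    and dens: "distributed N lborel X (\<lambda>x. ennreal (\<rho> ((x $ 1)\<^sup>2 + (x $ 2)\<^sup>2 + (x $ 3)\<^sup>2)))"
    and x0_pos: "x\<^sub>0 > 0"
    and density_pos: "sq_density \<rho> x\<^sub>0 > 0"
begin

text \<open>The function \<open>\<rho>\<close> is constrained only through its values at squared norms, so on the negative half-line it
may be neither nonnegative nor measurable.\<close>

definition radial_density :: "real \<Rightarrow> real" where "radial_density z = indicator {0<..} z * \<rho> z"

lemma radial_density_nonneg: "0 \<le> radial_density z"
  using rho_nonneg[of z] by (auto simp: radial_density_def indicator_def)

lemma density_norm: "distributed N lborel X (\<lambda>x. ennreal (\<rho> ((norm x)\<^sup>2)))"
  using dens by (simp add: power2_norm_vec3)

lemma X_measurable[measurable]: "X \<in> borel_measurable N"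
  using distributed_measurable[OF dens] by simp

text \<open>Only the composition of \<open>\<rho>\<close> with the squared norm is known to be measurable; restricting it to a ray
recovers \<open>\<rho>\<close> itself.\<close>

lemma radial_density_measurable[measurable]: "radial_density \<in> borel_measurable borel"
proof -
  have "(\<lambda>x::real^3. ennreal (\<rho> ((norm x)\<^sup>2))) \<in> borel_measurable borel"
    using distributed_borel_measurable[OF density_norm] by simp
  moreover have "(\<lambda>z. sqrt z *\<^sub>R axis 1 1 :: real ^ 3) \<in> borel_measurable borel" by measurable
  ultimately have "(\<lambda>z. ennreal (\<rho> ((norm (sqrt z *\<^sub>R axis 1 1 :: real ^ 3))\<^sup>2))) \<in> borel_measurable borel"
    by (rule measurable_compose_rev)
  then have [measurable]: "(\<lambda>z. ennreal (\<rho> ((sqrt z)\<^sup>2))) \<in> borel_measurable borel"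
    by (simp add: norm_axis_1)
  have "(\<lambda>z. indicator {0<..} z * enn2real (ennreal (\<rho> ((sqrt z)\<^sup>2)))) \<in> borel_measurable borel"
    by measurable
  also have "(\<lambda>z. indicator {0<..} z * enn2real (ennreal (\<rho> ((sqrt z)\<^sup>2)))) = radial_density"
    using rho_nonneg by (auto simp: radial_density_def fun_eq_iff indicator_def)
  finally show ?thesis .
qed

lemma set_integral_radial_density:
  assumes "u \<ge> 0"
  shows "(LINT z:{u<..}|lborel. radial_density z / sqrt (z - u)) = (LINT z:{u<..}|lborel. \<rho> z / sqrt (z - u))"
  unfolding set_lebesgue_integral_def using assms
  by (intro Bochner_Integration.integral_cong) (auto simp: radial_density_def indicator_def)

text \<open>The total mass \<open>1\<close> bounds the integral of \<open>2 \<pi> sqrt z \<rho> z\<close>, and \<open>sqrt z \<ge> sqrt x\<^sub>0\<close> on the range of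
integration.\<close>

lemma integrable_radial_density: "integrable lborel (\<lambda>z. indicator {x\<^sub>0<..} z * radial_density z)"
proof -
  have "1 = emeasure (distr N lborel X) (space lborel)"
    using X_measurable by (subst emeasure_distr) (auto simp: emeasure_space_1)
  also have "\<dots> = (\<integral>\<^sup>+x. ennreal (\<rho> ((norm x)\<^sup>2)) \<partial>(lborel :: (real^3) measure))"
    using distributed_borel_measurable[OF density_norm]
    by (simp add: distributed_distr_eq_density[OF density_norm] emeasure_density)
  also have "\<dots> \<ge> (\<integral>\<^sup>+x. ennreal (radial_density ((norm x)\<^sup>2)) \<partial>(lborel :: (real^3) measure))"
    using rho_nonneg by (intro nn_integral_mono) (auto simp: radial_density_def indicator_def)
  finally have "(\<integral>\<^sup>+z. ennreal (2 * pi * sqrt z) * indicator {0..} z * ennreal (radial_density z) \<partial>lborel) \<le> 1"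
    by (subst (asm) nn_integral_radial_vec3) simp_all
  moreover have "(\<integral>\<^sup>+z. ennreal (2 * pi * sqrt x\<^sub>0) * ennreal (indicator {x\<^sub>0<..} z * radial_density z) \<partial>lborel)
      \<le> (\<integral>\<^sup>+z. ennreal (2 * pi * sqrt z) * indicator {0..} z * ennreal (radial_density z) \<partial>lborel)"
    using x0_pos by (intro nn_integral_mono) (auto simp: indicator_def intro!: mult_right_mono ennreal_leI)
  ultimately have "ennreal (2 * pi * sqrt x\<^sub>0) * (\<integral>\<^sup>+z. ennreal (indicator {x\<^sub>0<..} z * radial_density z) \<partial>lborel) \<le> 1"
    by (subst (asm) nn_integral_cmult) auto
  then have "(\<integral>\<^sup>+z. ennreal (indicator {x\<^sub>0<..} z * radial_density z) \<partial>lborel) \<noteq> \<infinity>"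
    using x0_pos by (auto simp: ennreal_mult_top top_unique)
  then show ?thesis
    using radial_density_nonneg by (intro integrableI_nonneg) (auto simp: less_top)
qed

lemma not_AE_radial_density_zero: "\<not> (AE z in lborel. x\<^sub>0 < z \<longrightarrow> radial_density z = 0)"
proof
  assume "AE z in lborel. x\<^sub>0 < z \<longrightarrow> radial_density z = 0"
  then have "(LINT z:{x\<^sub>0<..}|lborel. radial_density z / sqrt (z - x\<^sub>0)) = 0"
    unfolding set_lebesgue_integral_def
    by (intro integral_eq_zero_AE) (auto elim!: eventually_mono simp: indicator_def)
  then show False
    using density_pos x0_pos set_integral_radial_density[of x\<^sub>0] by (simp add: sq_density_def)
qed

text \<open>Up to a constant, the Abel transform applied twice is integration: \<open>V_model \<rho> x\<^sub>0\<close> is \<open>\<pi>\<^sup>2\<close> times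
the integral of \<open>\<rho>\<close> over \<open>{x\<^sub>0<..}\<close>, which is finite and positive.\<close>

lemma V_model_pos: "V_model \<rho> x\<^sub>0 > 0"
proof -
  let ?I = "\<integral>z. indicator {x\<^sub>0<..} z * radial_density z \<partial>lborel"
  note abel = abel_transform_integral(2)[where \<mu> = lborel and w = radial_density and a = x\<^sub>0 and b = x\<^sub>0,
      OF sets_lborel lborel.sigma_finite_measure_axioms radial_density_measurable radial_density_nonneg integrable_radial_density order_refl]
  have "V_model \<rho> x\<^sub>0 = (LINT u:{x\<^sub>0<..}|lborel. pi * ((LINT z:{u<..}|lborel. radial_density z / sqrt (z - u)) / sqrt (u - x\<^sub>0)))"
    unfolding V_model_def sq_density_def using x0_pos
    by (intro set_lebesgue_integral_cong) (auto simp: set_integral_radial_density)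
  also have "\<dots> = pi * (\<integral>z. indicator {x\<^sub>0<..} z * radial_density z * pi \<partial>lborel)"
    by (simp only: set_integral_mult_right abel) simp
  also have "\<dots> = pi * (pi * ?I)" by simp
  finally have V: "V_model \<rho> x\<^sub>0 = pi * (pi * ?I)" .
  have "?I \<noteq> 0"
  proof
    assume "?I = 0"
    then have "AE z in lborel. indicator {x\<^sub>0<..} z * radial_density z = 0"
      using integrable_radial_density radial_density_nonneg by (subst (asm) integral_nonneg_eq_0_iff_AE) auto
    then have "AE z in lborel. x\<^sub>0 < z \<longrightarrow> radial_density z = 0" by eventually_elim (auto simp: indicator_def)
    then show False using not_AE_radial_density_zero by simp
  qed
  moreover have "?I \<ge> 0" using radial_density_nonneg by (intro Bochner_Integration.integral_nonneg) simp
  ultimately show ?thesis unfolding V by simp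
qed

abbreviation Y :: "'b \<Rightarrow> real" where "Y \<omega> \<equiv> (X \<omega> $ 1)\<^sup>2 + (X \<omega> $ 2)\<^sup>2"

lemma Y_measurable[measurable]: "Y \<in> borel_measurable N"
proof -
  have [measurable]: "(\<lambda>x :: real ^ 3. (x $ 1)\<^sup>2 + (x $ 2)\<^sup>2) \<in> borel_measurable borel"
    by (intro borel_measurable_continuous_onI continuous_intros)
  show ?thesis by measurable
qed

lemma AE_distributed_iff:
  assumes "Measurable.pred borel Q"
  shows "(AE \<omega> in N. Q (X \<omega>)) \<longleftrightarrow> (AE x in lborel. 0 < \<rho> ((norm x)\<^sup>2) \<longrightarrow> Q x)"
proof -
  have "(AE \<omega> in N. Q (X \<omega>)) \<longleftrightarrow> (AE x in distr N lborel X. Q x)"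
    using assms X_measurable by (subst AE_distr_iff) auto
  also have "\<dots> \<longleftrightarrow> (AE x in lborel. 0 < ennreal (\<rho> ((norm x)\<^sup>2)) \<longrightarrow> Q x)"
    using distributed_borel_measurable[OF density_norm]
    by (simp only: distributed_distr_eq_density[OF density_norm] AE_density)
  finally show ?thesis by (simp add: ennreal_less_zero_iff)
qed

lemma AE_Y_neq: "AE \<omega> in N. Y \<omega> \<noteq> c"
proof -
  have "{x :: real ^ 3. (x $ 1)\<^sup>2 + (x $ 2)\<^sup>2 = c} \<in> null_sets lebesgue"
    using negligible_cylinder_vec3 by (simp add: negligible_iff_null_sets)
  then have "AE x in (lebesgue :: (real ^ 3) measure). (x $ 1)\<^sup>2 + (x $ 2)\<^sup>2 \<noteq> c"
    by (rule AE_I') auto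
  then have "AE x in (lborel :: (real ^ 3) measure). (x $ 1)\<^sup>2 + (x $ 2)\<^sup>2 \<noteq> c"
    by (simp add: AE_completion_iff)
  then have "AE x in (lborel :: (real ^ 3) measure). 0 < \<rho> ((norm x)\<^sup>2) \<longrightarrow> (x $ 1)\<^sup>2 + (x $ 2)\<^sup>2 \<noteq> c"
    by eventually_elim simp
  then show ?thesis by (subst AE_distributed_iff) simp_all
qed

text \<open>Otherwise \<open>\<rho>\<close> would vanish outside the cylinder of squared radius \<open>x\<^sub>0\<close>, by rotation outside the ball
of squared radius \<open>x\<^sub>0\<close>, and the density of the squared norm would vanish beyond \<open>x\<^sub>0\<close>, against
\<open>sq_density \<rho> x\<^sub>0 > 0\<close>.\<close>

lemma not_AE_Y_le: "\<not> (AE \<omega> in N. Y \<omega> \<le> x\<^sub>0)"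
proof
  assume "AE \<omega> in N. Y \<omega> \<le> x\<^sub>0"
  then have "AE x in (lborel :: (real ^ 3) measure). 0 < \<rho> ((norm x)\<^sup>2) \<longrightarrow> (x $ 1)\<^sup>2 + (x $ 2)\<^sup>2 \<le> x\<^sub>0"
    by (subst (asm) AE_distributed_iff) simp_all
  then have "AE x in (lborel :: (real ^ 3) measure). x\<^sub>0 < (x $ 1)\<^sup>2 + (x $ 2)\<^sup>2 \<longrightarrow> radial_density ((norm x)\<^sup>2) = 0"
  proof eventually_elim
    case (elim x)
    then show ?case using rho_nonneg[of "(norm x)\<^sup>2"] by (auto simp: radial_density_def)
  qed
  then have "AE x in (lborel :: (real ^ 3) measure). x\<^sub>0 < (norm x)\<^sup>2 \<longrightarrow> radial_density ((norm x)\<^sup>2) = 0"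
    by (rule radial_property_off_cylinder_imp_off_ball)
  then have "AE x in (lborel :: (real ^ 3) measure). ennreal (indicator {x\<^sub>0<..} ((norm x)\<^sup>2) * radial_density ((norm x)\<^sup>2)) = 0"
    by eventually_elim (auto simp: indicator_def)
  then have "(\<integral>\<^sup>+x. ennreal (indicator {x\<^sub>0<..} ((norm x)\<^sup>2) * radial_density ((norm x)\<^sup>2)) \<partial>(lborel :: (real ^ 3) measure)) = 0"
    by (subst nn_integral_0_iff_AE) auto
  then have "(\<integral>\<^sup>+z. ennreal (2 * pi * sqrt z) * indicator {0..} z * ennreal (indicator {x\<^sub>0<..} z * radial_density z) \<partial>lborel) = 0"
    by (subst (asm) nn_integral_radial_vec3[where h = "\<lambda>z. ennreal (indicator {x\<^sub>0<..} z * radial_density z)"]) simp_all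
  then have "AE z in lborel. ennreal (2 * pi * sqrt z) * indicator {0..} z * ennreal (indicator {x\<^sub>0<..} z * radial_density z) = 0"
    by (subst (asm) nn_integral_0_iff_AE) simp_all
  then have "AE z in lborel. x\<^sub>0 < z \<longrightarrow> radial_density z = 0"
  proof eventually_elim
    case (elim z)
    show ?case
    proof
      assume "x\<^sub>0 < z"
      then have "0 < 2 * pi * sqrt z" using x0_pos by simp
      moreover have "ennreal (2 * pi * sqrt z) * ennreal (radial_density z) = 0"
        using elim \<open>x\<^sub>0 < z\<close> x0_pos by simp
      then have "2 * pi * sqrt z \<le> 0 \<or> radial_density z \<le> 0"
        by (simp only: mult_eq_0_iff ennreal_eq_0_iff)
      ultimately show "radial_density z = 0" using radial_density_nonneg[of z] by linarith
    qed
  qed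
  then show False using not_AE_radial_density_zero by simp
qed

lemma tail_angle_Y_integrable:
  "integrable N (\<lambda>\<omega>. tail_angle x\<^sub>0 (Y \<omega>))" "integrable N (\<lambda>\<omega>. (tail_angle x\<^sub>0 (Y \<omega>))\<^sup>2)"
proof -
  note [measurable] = tail_angle_measurable[OF x0_pos]
  note b = tail_angle_bounds[OF x0_pos]
  have [measurable]: "(\<lambda>\<omega>. tail_angle x\<^sub>0 (Y \<omega>)) \<in> borel_measurable N"
    by (rule measurable_compose[OF Y_measurable]) measurable
  show "integrable N (\<lambda>\<omega>. tail_angle x\<^sub>0 (Y \<omega>))"
  proof (rule integrable_const_bound[where B = "pi / 2"])
    show "AE \<omega> in N. norm (tail_angle x\<^sub>0 (Y \<omega>)) \<le> pi / 2"
      using b by (intro AE_I2) (simp only: real_norm_def abs_of_nonneg)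
  qed measurable
  show "integrable N (\<lambda>\<omega>. (tail_angle x\<^sub>0 (Y \<omega>))\<^sup>2)"
  proof (rule integrable_const_bound[where B = "(pi / 2)\<^sup>2"])
    show "AE \<omega> in N. norm ((tail_angle x\<^sub>0 (Y \<omega>))\<^sup>2) \<le> (pi / 2)\<^sup>2"
      using power_mono[OF b(2) b(1), of _ 2] by (intro AE_I2) (simp only: real_norm_def abs_power2)
  qed measurable
qed

text \<open>Almost surely the two variables add up to \<open>\<pi> / 2\<close>.  The exception is \<open>Y = 0\<close>, where \<open>x\<^sub>0 / Y\<close> has the
default value \<open>0\<close>.\<close>

lemma variance_arcsin:
  "variance (\<lambda>\<omega>. arcsin (sqrt (min 1 (x\<^sub>0 / Y \<omega>)))) = variance (\<lambda>\<omega>. tail_angle x\<^sub>0 (Y \<omega>))"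
proof -
  note [measurable] = tail_angle_measurable[OF x0_pos]
  have [measurable]: "(\<lambda>\<omega>. tail_angle x\<^sub>0 (Y \<omega>)) \<in> borel_measurable N"
    by (rule measurable_compose[OF Y_measurable]) measurable
  define U where "U \<omega> = arcsin (sqrt (min 1 (x\<^sub>0 / Y \<omega>)))" for \<omega>
  have eq: "AE \<omega> in N. U \<omega> = pi / 2 - tail_angle x\<^sub>0 (Y \<omega>)"
    using AE_Y_neq[of 0]
  proof eventually_elim
    case (elim \<omega>)
    then have "Y \<omega> > 0" using sum_power2_ge_zero[of "X \<omega> $ 1" "X \<omega> $ 2"] by (metis order_le_less)
    then show ?case using x0_pos
      by (auto simp: U_def tail_angle_eq min_def indicator_def field_simps)
  qed
  have cont: "continuous_on {0..1} arcsin"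
    by (rule continuous_on_subset[OF continuous_on_arcsin']) auto
  have "(\<lambda>y. if y \<in> {0..1} then arcsin y else 0) \<in> borel_measurable borel"
    by (intro borel_measurable_continuous_on_if continuous_on_const cont) auto
  moreover have "(\<lambda>\<omega>. sqrt (min 1 (x\<^sub>0 / Y \<omega>))) \<in> borel_measurable N"
    by (intro measurable_compose[OF _ borel_measurable_sqrt] borel_measurable_min borel_measurable_divide
        borel_measurable_const Y_measurable)
  ultimately have "(\<lambda>\<omega>. if sqrt (min 1 (x\<^sub>0 / Y \<omega>)) \<in> {0..1} then arcsin (sqrt (min 1 (x\<^sub>0 / Y \<omega>))) else 0) \<in> borel_measurable N"
    by (rule measurable_compose_rev)
  also have "(\<lambda>\<omega>. if sqrt (min 1 (x\<^sub>0 / Y \<omega>)) \<in> {0..1} then arcsin (sqrt (min 1 (x\<^sub>0 / Y \<omega>))) else 0) = U"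
    using x0_pos by (auto simp: U_def fun_eq_iff)
  finally have [measurable]: "U \<in> borel_measurable N" .
  have "expectation U = expectation (\<lambda>\<omega>. pi / 2 - tail_angle x\<^sub>0 (Y \<omega>))"
    using eq by (intro integral_cong_AE) auto
  also have "\<dots> = pi / 2 - expectation (\<lambda>\<omega>. tail_angle x\<^sub>0 (Y \<omega>))"
    using tail_angle_Y_integrable by (simp add: prob_space)
  finally have E: "expectation U = pi / 2 - expectation (\<lambda>\<omega>. tail_angle x\<^sub>0 (Y \<omega>))" .
  have "variance U = variance (\<lambda>\<omega>. tail_angle x\<^sub>0 (Y \<omega>))"
    unfolding E using eq
    by (intro integral_cong_AE) (auto elim!: eventually_mono simp: power2_commute)
  then show ?thesis by (simp add: U_def[abs_def])
qed

text \<open>If the angle were almost surely a constant \<open>m\<close>, then either \<open>m = 0\<close> and \<open>Y \<le> x\<^sub>0\<close> almost surely, or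
\<open>Y\<close> would have an atom of full mass, as the angle is injective beyond \<open>x\<^sub>0\<close>.\<close>

lemma variance_tail_angle_pos: "variance (\<lambda>\<omega>. tail_angle x\<^sub>0 (Y \<omega>)) > 0"
proof -
  note [measurable] = tail_angle_measurable[OF x0_pos]
  let ?A = "\<lambda>\<omega>. tail_angle x\<^sub>0 (Y \<omega>)"
  have [measurable]: "?A \<in> borel_measurable N"
    by (rule measurable_compose[OF Y_measurable]) measurable
  define m where "m = expectation ?A"
  have nz: "variance ?A \<noteq> 0"
  proof
    assume "variance ?A = 0"
    moreover have "integrable N (\<lambda>\<omega>. (?A \<omega> - m)\<^sup>2)"
    proof (rule integrable_const_bound)
      show "AE \<omega> in N. norm ((?A \<omega> - m)\<^sup>2) \<le> (pi / 2 + \<bar>m\<bar>)\<^sup>2"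
      proof (rule AE_I2)
        fix \<omega>
        have "\<bar>?A \<omega> - m\<bar> \<le> \<bar>pi / 2 + \<bar>m\<bar>\<bar>"
          using tail_angle_bounds[OF x0_pos, of "Y \<omega>"] by linarith
        then have "(?A \<omega> - m)\<^sup>2 \<le> (pi / 2 + \<bar>m\<bar>)\<^sup>2"
          by (rule abs_le_square_iff[THEN iffD1])
        then show "norm ((?A \<omega> - m)\<^sup>2) \<le> (pi / 2 + \<bar>m\<bar>)\<^sup>2" by simp
      qed
    qed measurable
    ultimately have A: "AE \<omega> in N. ?A \<omega> = m"
      by (subst (asm) integral_nonneg_eq_0_iff_AE) (auto simp: m_def)
    show False
    proof (cases "m = 0")
      case True
      from A have "AE \<omega> in N. Y \<omega> \<le> x\<^sub>0"
      proof eventually_elim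
        case (elim \<omega>)
        show ?case
        proof (rule ccontr)
          assume "\<not> Y \<omega> \<le> x\<^sub>0"
          then have "arcsin (sqrt (x\<^sub>0 / Y \<omega>)) < arcsin 1"
            using x0_pos by (intro arcsin_less_arcsin) (auto simp: order_trans[of "-1" 0])
          then show False using elim True \<open>\<not> Y \<omega> \<le> x\<^sub>0\<close> by (simp add: tail_angle_eq[OF x0_pos])
        qed
      qed
      then show False using not_AE_Y_le by simp
    next
      case False
      \<comment> \<open>the solution \<open>y\<close> of \<open>arccos (sqrt (x\<^sub>0 / y)) = m\<close>\<close>
      define c where "c = x\<^sub>0 / (cos m)\<^sup>2"
      have "AE \<omega> in N. Y \<omega> = c"
        using A
      proof eventually_elim
        case (elim \<omega>)
        with False have Y: "Y \<omega> > x\<^sub>0" by (auto simp: tail_angle_eq[OF x0_pos] indicator_def split: if_splits)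
        have "cos m = sqrt (x\<^sub>0 / Y \<omega>)"
          unfolding elim[symmetric] tail_angle_def using Y x0_pos
          by (subst cos_arccos) (auto simp: order_trans[of "-1" 0] max_def)
        then have "(cos m)\<^sup>2 = x\<^sub>0 / Y \<omega>" using Y x0_pos by simp
        then show ?case using Y x0_pos by (simp add: c_def)
      qed
      then have "AE \<omega> in N. False" using AE_Y_neq[of c] by eventually_elim simp
      then show False by simp
    qed
  qed
  show ?thesis
    by (rule order.not_eq_order_implies_strict[OF not_sym[OF nz] variance_positive])
qed

end

section \<open>The sampled array\<close>

lemma distribution_function_nonneg_facts:
  assumes "distribution_function_nonneg H"
  shows distribution_function_real_distribution: "real_distribution (interval_measure H)"
    and distribution_function_cdf: "cdf (interval_measure H) = H"
    and distribution_function_measure_Ioc: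
      "\<And>a b. a \<le> b \<Longrightarrow> measure (interval_measure H) {a<..b} = H b - H a"
    and distribution_function_le_1: "\<And>t. H t \<le> 1"
    and distribution_function_nonneg_val: "\<And>t. 0 \<le> H t"
proof -
  from assms have mono: "mono H" and cont: "\<And>t. continuous (at_right t) H"
    and zero: "\<And>t. t < 0 \<Longrightarrow> H t = 0" and top: "(H \<longlongrightarrow> 1) at_top"
    by (auto simp: distribution_function_nonneg_def)
  have bot: "(H \<longlongrightarrow> 0) at_bot"
    by (rule tendsto_eventually) (use zero in \<open>auto simp: eventually_at_bot_dense intro!: exI[of _ 0]\<close>)
  show rd: "real_distribution (interval_measure H)"
    by (rule real_distribution_interval_measure) (use mono cont bot top in \<open>auto dest: monoD\<close>)
  show cdf: "cdf (interval_measure H) = H"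
    by (rule cdf_interval_measure) (use mono cont bot in \<open>auto dest: monoD\<close>)
  interpret R: real_distribution "interval_measure H" by (rule rd)
  show "H t \<le> 1" for t using R.cdf_bounded_prob[of t] by (simp add: cdf)
  show "0 \<le> H t" for t using R.cdf_nonneg[of t] by (simp add: cdf)
  show "measure (interval_measure H) {a<..b} = H b - H a" if "a \<le> b" for a b
    using R.cdf_diff_eq[of a b] that by (cases "a = b") (auto simp: cdf)
qed

text \<open>The quantile function is a monotone pseudo-inverse on the open unit interval.  Its default values elsewhere, the
infimum of the whole line and of the empty set, are unspecified but constant.\<close>

lemma quantile_measurable:
  assumes "distribution_function_nonneg H"
  shows "quantile H \<in> borel_measurable borel"
proof -
  interpret R: cdf_distribution "interval_measure H"
    unfolding cdf_distribution_def by (rule distribution_function_real_distribution[OF assms])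
  note cdf = distribution_function_cdf[OF assms]
  have low: "quantile H u = Inf UNIV" if "u \<le> 0" for u
  proof -
    have "{x. u \<le> H x} = UNIV"
      using distribution_function_nonneg_val[OF assms] that by (auto intro: order_trans)
    then show ?thesis by (simp add: quantile_def)
  qed
  have high: "quantile H u = Inf {}" if "1 < u" for u
  proof -
    have "{x. u \<le> H x} = {}"
      using distribution_function_le_1[OF assms] that by (auto simp: not_le intro: le_less_trans)
    then show ?thesis by (simp add: quantile_def)
  qed
  show ?thesis
  proof (rule borel_measurable_piecewise_mono[of "{{..0}, {0<..<1}, {1}, {1<..}}"])
    fix c :: "real set" assume "c \<in> {{..0}, {0<..<1}, {1}, {1<..}}"
    moreover have "mono_on {0<..<1} (quantile H)"
      using R.mono_I by (simp add: quantile_def[abs_def] cdf)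
    ultimately show "mono_on c (quantile H)"
      by (auto simp: mono_on_def low high)
  qed auto
qed

lemma (in prob_space) distr_quantile:
  assumes H: "distribution_function_nonneg H"
    and [measurable]: "U \<in> borel_measurable M"
    and U: "distr M borel U = uniform_measure lborel {0<..<1}"
  shows "distr M borel (\<lambda>\<omega>. quantile H (U \<omega>)) = interval_measure H"
proof -
  interpret R: cdf_distribution "interval_measure H"
    unfolding cdf_distribution_def by (rule distribution_function_real_distribution[OF H])
  note [measurable] = quantile_measurable[OF H]
  have q: "(\<lambda>u. Inf {x. u \<le> cdf (interval_measure H) x}) = quantile H"
    by (simp add: quantile_def[abs_def] distribution_function_cdf[OF H])
  have "distr M borel (\<lambda>\<omega>. quantile H (U \<omega>)) = distr (distr M borel U) borel (quantile H)"
    by (subst distr_distr) (auto simp: comp_def)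
  also have "\<dots> = distr (restrict_space lborel {0<..<1}) borel (quantile H)"
    unfolding U
  proof (rule measure_eqI)
    fix B assume "B \<in> sets (distr (uniform_measure lborel {0<..<1}) borel (quantile H))"
    then have B[measurable]: "B \<in> sets borel" by simp
    have m: "quantile H \<in> borel_measurable (restrict_space lborel {0<..<1})"
      by (intro measurable_restrict_space1) simp
    have vB: "quantile H -` B \<in> sets lborel"
      using measurable_sets[OF quantile_measurable[OF H] B] by simp
    have "emeasure (distr (uniform_measure lborel {0<..<1}) borel (quantile H)) B
        = emeasure lborel ({0<..<1} \<inter> quantile H -` B)"
      using vB by (subst emeasure_distr) (auto simp: divide_ennreal_def)
    also have "\<dots> = emeasure (distr (restrict_space lborel {0<..<1}) borel (quantile H)) B"
      using m by (subst emeasure_distr) (auto simp: space_restrict_space emeasure_restrict_space Int_commute)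
    finally show "emeasure (distr (uniform_measure lborel {0<..<1}) borel (quantile H)) B
        = emeasure (distr (restrict_space lborel {0<..<1}) borel (quantile H)) B" .
  qed simp
  also have "\<dots> = interval_measure H"
    using R.distr_I_eq_M unfolding q .
  finally show ?thesis .
qed

lemma (in prob_space) second_moment_sum_indep:
  fixes Z :: "nat \<Rightarrow> 'a \<Rightarrow> real"
  assumes "finite I" and "indep_vars (\<lambda>_. borel) Z I"
    and "\<And>i. i \<in> I \<Longrightarrow> integrable M (\<lambda>\<omega>. (Z i \<omega>)\<^sup>2)" and "\<And>i. i \<in> I \<Longrightarrow> expectation (Z i) = 0"
  shows "integrable M (\<lambda>\<omega>. (\<Sum>i\<in>I. Z i \<omega>)\<^sup>2)
    \<and> expectation (\<lambda>\<omega>. (\<Sum>i\<in>I. Z i \<omega>)\<^sup>2) = (\<Sum>i\<in>I. expectation (\<lambda>\<omega>. (Z i \<omega>)\<^sup>2))"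
  using assms
proof (induction I)
  case (insert i I)
  let ?S = "\<lambda>\<omega>. \<Sum>j\<in>I. Z j \<omega>"
  have Z[measurable]: "Z j \<in> borel_measurable M" if "j \<in> insert i I" for j
    using insert.prems(1) that unfolding indep_vars_def by blast
  have int: "integrable M (Z j)" if "j \<in> insert i I" for j
    by (rule square_integrable_imp_integrable[OF Z[OF that] insert.prems(2)[OF that]])
  have IH: "integrable M (\<lambda>\<omega>. (?S \<omega>)\<^sup>2)"
    "expectation (\<lambda>\<omega>. (?S \<omega>)\<^sup>2) = (\<Sum>j\<in>I. expectation (\<lambda>\<omega>. (Z j \<omega>)\<^sup>2))"
    using insert.IH insert.prems indep_vars_subset[OF insert.prems(1), of I] by auto
  have ind: "indep_var borel (Z i) borel ?S"
    by (rule indep_vars_sum) (use insert in auto)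
  have intS: "integrable M ?S" using int by auto
  have prod: "integrable M (\<lambda>\<omega>. Z i \<omega> * ?S \<omega>)" "expectation (\<lambda>\<omega>. Z i \<omega> * ?S \<omega>) = 0"
    using indep_var_integrable[OF ind] indep_var_lebesgue_integral[OF ind] int[of i] intS insert.prems(3)
    by auto
  have sq: "(\<Sum>j\<in>insert i I. Z j \<omega>)\<^sup>2 = (Z i \<omega>)\<^sup>2 + (?S \<omega>)\<^sup>2 + 2 * (Z i \<omega> * ?S \<omega>)" for \<omega>
    using insert.hyps by (simp add: power2_sum)
  have i2: "integrable M (\<lambda>\<omega>. (Z i \<omega>)\<^sup>2)" using insert.prems(2) by simp
  have "expectation (\<lambda>\<omega>. (Z i \<omega>)\<^sup>2 + (?S \<omega>)\<^sup>2 + 2 * (Z i \<omega> * ?S \<omega>))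
      = expectation (\<lambda>\<omega>. (Z i \<omega>)\<^sup>2) + expectation (\<lambda>\<omega>. (?S \<omega>)\<^sup>2) + 2 * expectation (\<lambda>\<omega>. Z i \<omega> * ?S \<omega>)"
    using i2 IH(1) prod(1) by simp
  with i2 IH prod insert.hyps show ?case unfolding sq by simp
qed simp

lemma eps_seq_facts:
  assumes "n \<ge> 2"
  defines "s \<equiv> sqrt (real n * ln (real n))"
  shows "s > 0" "s\<^sup>2 = real n * ln (real n)" "1 / eps_seq n = real n / s" "eps_seq n > 0"
proof -
  have ln: "ln (real n) > 0" using assms by simp
  then show "s > 0" "s\<^sup>2 = real n * ln (real n)" "eps_seq n > 0"
    using assms by (auto simp: s_def eps_seq_def)
  have "sqrt (real n) * sqrt (real n) = real n" by simp
  then show "1 / eps_seq n = real n / s"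
    using assms ln by (simp add: eps_seq_def s_def real_sqrt_divide real_sqrt_mult field_simps)
qed

lemma sqrt_n_ln_n_at_top: "filterlim (\<lambda>n. sqrt (real n * ln (real n))) at_top sequentially"
  by (intro filterlim_compose[OF sqrt_at_top] filterlim_at_top_mult_at_top filterlim_real_sequentially
      filterlim_compose[OF ln_at_top])

locale quantile_array = prob_space M
  for M :: "'a measure" +
  fixes T :: "nat \<Rightarrow> 'a \<Rightarrow> real" and Gn :: "nat \<Rightarrow> real \<Rightarrow> real" and Yn :: "nat \<Rightarrow> nat \<Rightarrow> 'a \<Rightarrow> real"
    and x\<^sub>0 :: real
  assumes T_indep: "indep_vars (\<lambda>_. borel) T {1..}"
    and T_unif: "\<And>i. i \<ge> 1 \<Longrightarrow> distr M borel (T i) = uniform_measure lborel {0<..<1}"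
    and Gn_df: "\<And>n. n \<ge> 1 \<Longrightarrow> distribution_function_nonneg (Gn n)"
    and Yn_eq: "\<And>n i \<omega>. Yn n i \<omega> = quantile (Gn n) (T i \<omega>)"
    and x0_pos: "x\<^sub>0 > 0"
begin

abbreviation \<mu> :: "nat \<Rightarrow> real measure" where "\<mu> n \<equiv> interval_measure (Gn n)"

lemma T_measurable: "i \<ge> 1 \<Longrightarrow> T i \<in> borel_measurable M"
  using T_indep by (auto simp: indep_vars_def)

lemma Yn_measurable: "i \<in> {1..n} \<Longrightarrow> Yn n i \<in> borel_measurable M"
  unfolding Yn_eq[abs_def]
  by (rule measurable_compose[OF T_measurable quantile_measurable]) (auto intro: Gn_df)

lemma Yn_law: "i \<in> {1..n} \<Longrightarrow> distr M borel (Yn n i) = \<mu> n"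
  unfolding Yn_eq[abs_def] by (rule distr_quantile) (auto intro: Gn_df T_unif T_measurable)

lemma Yn_compose:
  assumes [measurable]: "f \<in> borel_measurable borel"
  shows "indep_vars (\<lambda>_. borel) (\<lambda>i \<omega>. f (Yn n i \<omega>)) {1..n}"
    and "i \<in> {1..n} \<Longrightarrow> distr M borel (\<lambda>\<omega>. f (Yn n i \<omega>)) = distr (\<mu> n) borel f"
proof -
  have "indep_vars (\<lambda>_. borel) T {1..n}" by (rule indep_vars_subset[OF T_indep]) auto
  then show "indep_vars (\<lambda>_. borel) (\<lambda>i \<omega>. f (Yn n i \<omega>)) {1..n}"
    unfolding Yn_eq
    by (rule indep_vars_compose2) (auto intro!: measurable_compose[OF quantile_measurable assms] Gn_df)
  assume i: "i \<in> {1..n}"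
  have [measurable]: "Yn n i \<in> borel_measurable M" using i by (rule Yn_measurable)
  show "distr M borel (\<lambda>\<omega>. f (Yn n i \<omega>)) = distr (\<mu> n) borel f"
    unfolding Yn_law[OF i, symmetric] by (subst distr_distr) (auto simp: comp_def)
qed

lemma \<mu>_dist: "n \<ge> 1 \<Longrightarrow> real_distribution (\<mu> n)"
  by (rule distribution_function_real_distribution[OF Gn_df])

lemma Yn_integral:
  fixes f :: "real \<Rightarrow> real"
  assumes "f \<in> borel_measurable borel" "i \<in> {1..n}"
  shows "expectation (\<lambda>\<omega>. f (Yn n i \<omega>)) = (\<integral>y. f y \<partial>\<mu> n)"
  unfolding Yn_law[OF assms(2), symmetric]
  by (rule integral_distr[symmetric, OF Yn_measurable assms(1)]) fact

definition angle_mean :: "nat \<Rightarrow> real" where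
  "angle_mean n = (\<integral>y. tail_angle x\<^sub>0 y \<partial>\<mu> n)"

definition angle_dev :: "nat \<Rightarrow> real \<Rightarrow> real" where
  "angle_dev n y = tail_angle x\<^sub>0 y - angle_mean n"

lemma angle_dev_measurable[measurable]: "angle_dev n \<in> borel_measurable borel"
  using tail_angle_measurable[OF x0_pos] unfolding angle_dev_def by simp

lemma tail_angle_integrable:
  assumes "n \<ge> 1" shows "integrable (\<mu> n) (tail_angle x\<^sub>0)"
proof -
  interpret R: real_distribution "\<mu> n" by (rule \<mu>_dist[OF assms])
  have [measurable]: "tail_angle x\<^sub>0 \<in> borel_measurable borel" by (rule tail_angle_measurable[OF x0_pos])
  show ?thesis
    using tail_angle_bounds[OF x0_pos]
    by (intro R.integrable_const_bound[where B = "pi / 2"]) (auto intro!: AE_I2 simp: abs_of_nonneg)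
qed

lemma angle_mean_bounds:
  assumes "n \<ge> 1" shows "0 \<le> angle_mean n" "angle_mean n \<le> pi / 2"
proof -
  interpret R: real_distribution "\<mu> n" by (rule \<mu>_dist[OF assms])
  show "0 \<le> angle_mean n" unfolding angle_mean_def
    using tail_angle_bounds[OF x0_pos] by (intro Bochner_Integration.integral_nonneg) auto
  show "angle_mean n \<le> pi / 2" unfolding angle_mean_def
    using tail_angle_bounds[OF x0_pos] tail_angle_integrable[OF assms]
    by (intro R.integral_le_const) auto
qed

lemma angle_dev_bound:
  assumes "n \<ge> 1" shows "\<bar>angle_dev n y\<bar> \<le> 2"
proof -
  have "\<bar>angle_dev n y\<bar> \<le> pi / 2"
    using tail_angle_bounds[OF x0_pos, of y] angle_mean_bounds[OF assms] unfolding angle_dev_def by linarith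
  then show ?thesis using pi_less_4 by linarith
qed

lemma angle_dev_moments:
  assumes "n \<ge> 1"
  shows "integrable (\<mu> n) (angle_dev n)" "(\<integral>y. angle_dev n y \<partial>\<mu> n) = 0"
    and "integrable (\<mu> n) (\<lambda>y. (angle_dev n y)\<^sup>2)" "(\<integral>y. (angle_dev n y)\<^sup>2 \<partial>\<mu> n) \<le> 4"
proof -
  interpret R: real_distribution "\<mu> n" by (rule \<mu>_dist[OF assms])
  show "integrable (\<mu> n) (angle_dev n)" "(\<integral>y. angle_dev n y \<partial>\<mu> n) = 0"
    using tail_angle_integrable[OF assms] R.prob_space
    by (auto simp: angle_dev_def[abs_def] angle_mean_def simp del: R.space_eq_univ)
  have b: "(angle_dev n y)\<^sup>2 \<le> 4" for y
    using abs_le_square_iff[THEN iffD1, of "angle_dev n y" 2] angle_dev_bound[OF assms, of y] by simp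
  show i: "integrable (\<mu> n) (\<lambda>y. (angle_dev n y)\<^sup>2)"
    using b by (intro R.integrable_const_bound[where B = 4]) auto
  show "(\<integral>y. (angle_dev n y)\<^sup>2 \<partial>\<mu> n) \<le> 4"
    using b i by (intro R.integral_le_const) auto
qed

lemma integral_V_diff:
  assumes "n \<ge> 1"
  shows "(LINT u:{x\<^sub>0<..}|lborel. (V_emp n y u - V_of (Gn n) u) / (2 * sqrt u))
    = (\<Sum>i=1..n. angle_dev n (y i)) / real n"
proof -
  note e = V_emp_integral[OF x0_pos, of n y] and v = V_of_integral[OF x0_pos \<mu>_dist[OF assms]]
  have "(LINT u:{x\<^sub>0<..}|lborel. (V_emp n y u - V_of (Gn n) u) / (2 * sqrt u))
      = (LINT u:{x\<^sub>0<..}|lborel. V_emp n y u / (2 * sqrt u) - V_of (Gn n) u / (2 * sqrt u))"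
    by (simp add: diff_divide_distrib)
  also have "\<dots> = (\<Sum>i=1..n. tail_angle x\<^sub>0 (y i)) / real n - angle_mean n"
    using set_integral_diff(2)[OF e(1) v(1)] e(2) v(2) by (simp add: angle_mean_def)
  also have "\<dots> = (\<Sum>i=1..n. angle_dev n (y i)) / real n"
    using assms by (simp add: angle_dev_def sum_subtractf field_simps)
  finally show ?thesis .
qed

text \<open>Here the summands are bounded by \<open>2 / sqrt n\<close>, so the truncation is void and the tails vanish for
large \<open>n\<close>.\<close>

lemma angle_dev_central_limit:
  assumes var: "(\<lambda>n. \<integral>y. (angle_dev n y)\<^sup>2 \<partial>\<mu> n) \<longlonglongrightarrow> v" and "v > 0"
  shows "weak_conv_m (\<lambda>n. distr M borel (\<lambda>\<omega>. \<Sum>i=1..n. angle_dev n (Yn n i \<omega>) / sqrt (real n)))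
    (centered_normal v)"
proof (rule rowwise_iid_central_limit_theorem)
  define \<nu> where "\<nu> n = distr (\<mu> n) borel (\<lambda>y. angle_dev n y / sqrt (real n))" for n
  have meas: "(\<lambda>y. angle_dev n y / sqrt (real n)) \<in> borel_measurable borel" for n by measurable
  show "indep_vars (\<lambda>_. borel) (\<lambda>i \<omega>. angle_dev n (Yn n i \<omega>) / sqrt (real n)) {1..n}" for n
    by (rule Yn_compose(1)[OF meas])
  show "distr M borel (\<lambda>\<omega>. angle_dev n (Yn n i \<omega>) / sqrt (real n)) = \<nu> n" if "i \<in> {1..n}" for n i
    unfolding \<nu>_def by (rule Yn_compose(2)[OF meas that])
  have "filterlim (\<lambda>n. sqrt (real n)) at_top sequentially"
    by (rule filterlim_compose[OF sqrt_at_top filterlim_real_sequentially])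
  then have "(\<lambda>n. 2 / sqrt (real n)) \<longlonglongrightarrow> 0"
    by (intro tendsto_divide_0[OF tendsto_const] filterlim_at_top_imp_at_infinity)
  then have ev: "\<forall>\<^sub>F n in sequentially. n \<ge> 1 \<and> 2 / sqrt (real n) < \<delta>" if "\<delta> > 0" for \<delta>
    using that by (intro eventually_conj eventually_ge_at_top order_tendstoD(2))
  have small: "\<bar>angle_dev n y / sqrt (real n)\<bar> < \<delta>" if "n \<ge> 1 \<and> 2 / sqrt (real n) < \<delta>" for n y \<delta>
  proof -
    have "\<bar>angle_dev n y / sqrt (real n)\<bar> \<le> 2 / sqrt (real n)"
      using angle_dev_bound[of n y] that by (simp add: divide_right_mono)
    with that show ?thesis by linarith
  qed
  have ind: "indicator {-1<..<1} (angle_dev n y / sqrt (real n)) = (1 :: real)"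
    if "n \<ge> 1 \<and> 2 / sqrt (real n) < 1" for n y
  proof -
    have "- 1 < angle_dev n y / sqrt (real n)" "angle_dev n y / sqrt (real n) < 1"
      using small[OF that, of y] by linarith+
    then show ?thesis by simp
  qed
  show "(\<lambda>n. real n * measure (\<nu> n) {x. \<delta> \<le> \<bar>x\<bar>}) \<longlonglongrightarrow> 0" if "\<delta> > 0" for \<delta>
  proof (rule tendsto_eventually)
    show "\<forall>\<^sub>F n in sequentially. real n * measure (\<nu> n) {x. \<delta> \<le> \<bar>x\<bar>} = 0"
      using ev[OF that]
    proof eventually_elim
      case (elim n)
      have "(\<lambda>y. angle_dev n y / sqrt (real n)) -` {x. \<delta> \<le> \<bar>x\<bar>} = {}"
        using small[OF elim] by (auto simp: not_le[symmetric])
      then show ?case unfolding \<nu>_def by (subst measure_distr) auto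
    qed
  qed
  show "(\<lambda>n. real n * (\<integral>x. x * indicator {-1<..<1} x \<partial>\<nu> n)) \<longlonglongrightarrow> 0"
  proof (rule tendsto_eventually)
    show "\<forall>\<^sub>F n in sequentially. real n * (\<integral>x. x * indicator {-1<..<1} x \<partial>\<nu> n) = 0"
      using ev[OF zero_less_one]
    proof eventually_elim
      case (elim n)
      then show ?case unfolding \<nu>_def
        by (subst integral_distr) (simp_all add: ind angle_dev_moments)
    qed
  qed
  show "(\<lambda>n. real n * (\<integral>x. x\<^sup>2 * indicator {-1<..<1} x \<partial>\<nu> n)) \<longlonglongrightarrow> v"
  proof (rule Lim_transform_eventually[OF var])
    show "\<forall>\<^sub>F n in sequentially. (\<integral>y. (angle_dev n y)\<^sup>2 \<partial>\<mu> n) = real n * (\<integral>x. x\<^sup>2 * indicator {-1<..<1} x \<partial>\<nu> n)"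
      using ev[OF zero_less_one]
    proof eventually_elim
      case (elim n)
      then show ?case unfolding \<nu>_def
        by (subst integral_distr) (simp_all add: ind power_divide)
    qed
  qed
qed fact

definition scale :: "nat \<Rightarrow> real" where "scale n = sqrt (real n * ln (real n))"

abbreviation mean :: "nat \<Rightarrow> real" where "mean n \<equiv> V_of (Gn n) x\<^sub>0"

abbreviation cutoff :: "nat \<Rightarrow> real set" where "cutoff n \<equiv> {x\<^sub>0<..x\<^sub>0 + c_seq Gn x\<^sub>0 n}"

definition excess_dev :: "nat \<Rightarrow> real \<Rightarrow> real" where
  "excess_dev n y = (inv_sqrt_excess x\<^sub>0 y - mean n) / scale n"

lemma excess_dev_measurable[measurable]: "excess_dev n \<in> borel_measurable borel"
  unfolding excess_dev_def by measurable

lemma inv_sqrt_excess_le_iff: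
  assumes "r > 0"
  shows "r \<le> inv_sqrt_excess x\<^sub>0 y \<longleftrightarrow> y \<in> {x\<^sub>0<..x\<^sub>0 + 1 / r\<^sup>2}"
proof (cases "x\<^sub>0 < y")
  case True
  have "r \<le> inv_sqrt_excess x\<^sub>0 y \<longleftrightarrow> sqrt (y - x\<^sub>0) \<le> 1 / r"
    using True assms by (simp add: inv_sqrt_excess_def field_simps)
  also have "\<dots> \<longleftrightarrow> sqrt (y - x\<^sub>0) \<le> sqrt ((1 / r)\<^sup>2)"
    using assms by simp
  also have "\<dots> \<longleftrightarrow> y - x\<^sub>0 \<le> 1 / r\<^sup>2"
    by (simp only: real_sqrt_le_iff power_one_over)
  finally show ?thesis using True by auto
qed (use assms in \<open>auto simp: inv_sqrt_excess_def\<close>)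

text \<open>Write \<open>\<xi>\<close>, \<open>m\<close> and \<open>s\<close> for \<open>inv_sqrt_excess x\<^sub>0 y\<close>, \<open>mean n\<close> and \<open>scale n\<close>.  The cutoff
\<open>c_seq\<close> is \<open>1 / (s + m)\<^sup>2\<close>, chosen so that \<open>\<xi> \<ge> s + m\<close>, that is \<open>(\<xi> - m) / s \<ge> 1\<close>, holds
exactly on the cutoff interval; the lower truncation is void because \<open>\<xi> \<ge> 0\<close> and \<open>m < s\<close>.\<close>

lemma excess_dev_truncation:
  assumes "0 \<le> mean n" "mean n < scale n"
  shows "indicator {-1<..<1} (excess_dev n y) = (1 - indicator (cutoff n) y :: real)"
proof -
  have pos: "scale n > 0" "scale n + mean n > 0" using assms by auto
  have "excess_dev n y > - 1"
    using assms inv_sqrt_excess_nonneg[of x\<^sub>0 y] pos by (simp add: excess_dev_def field_simps)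
  moreover have "1 \<le> excess_dev n y \<longleftrightarrow> scale n + mean n \<le> inv_sqrt_excess x\<^sub>0 y"
    using pos by (auto simp: excess_dev_def field_simps)
  then have "1 \<le> excess_dev n y \<longleftrightarrow> y \<in> cutoff n"
    using inv_sqrt_excess_le_iff[OF pos(2)] by (simp add: c_seq_def scale_def)
  ultimately show ?thesis by (auto simp: indicator_def)
qed

text \<open>The hypothesis \<open>0 < mean n\<close> ensures that the integral defining \<open>mean n\<close> converges.  The means cancel, so
the truncated first moment involves only the cutoff interval.\<close>

lemma excess_dev_truncated_moments:
  assumes n: "n \<ge> 1" and m: "0 < mean n" "mean n < scale n"
  defines "b \<equiv> (LINT y:cutoff n|\<mu> n. 1 / sqrt (y - x\<^sub>0))"
    and "q \<equiv> (LINT y:{x\<^sub>0 + c_seq Gn x\<^sub>0 n<..}|\<mu> n. 1 / (y - x\<^sub>0))"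
    and "p \<equiv> measure (\<mu> n) (cutoff n)"
  shows "(\<integral>y. excess_dev n y * indicator {-1<..<1} (excess_dev n y) \<partial>\<mu> n) = (mean n * p - b) / scale n"
    and "(\<integral>y. (excess_dev n y)\<^sup>2 * indicator {-1<..<1} (excess_dev n y) \<partial>\<mu> n)
      = (q - 2 * mean n * (mean n - b) + (mean n)\<^sup>2 * (1 - p)) / (scale n)\<^sup>2"
proof -
  interpret R: real_distribution "\<mu> n" by (rule \<mu>_dist[OF n])
  let ?B = "cutoff n" and ?C = "{x\<^sub>0 + c_seq Gn x\<^sub>0 n<..}"
  let ?x = "inv_sqrt_excess x\<^sub>0"
  have c: "c_seq Gn x\<^sub>0 n > 0" using m by (simp add: c_seq_def scale_def[symmetric])
  have s: "scale n > 0" using m by simp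
  note trunc = excess_dev_truncation[OF less_imp_le[OF m(1)] m(2)]
  have ix: "integrable (\<mu> n) ?x"
    using m(1) not_integrable_integral_eq[of "\<mu> n" ?x] by (auto simp: V_of_eq)
  have ib: "integrable (\<mu> n) (\<lambda>y. indicator ?B y * ?x y)"
    using integrable_mult_indicator[OF _ ix, of ?B] by simp
  have ip: "integrable (\<mu> n) (indicator ?B :: real \<Rightarrow> real)"
    by (rule R.integrable_const_bound[where B = 1]) (auto simp: indicator_def)
  have iq: "integrable (\<mu> n) (\<lambda>y. indicator ?C y / (y - x\<^sub>0))"
  proof (rule R.integrable_const_bound[where B = "1 / c_seq Gn x\<^sub>0 n"])
    have "norm (indicator ?C y / (y - x\<^sub>0)) \<le> 1 / c_seq Gn x\<^sub>0 n" for y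
      using c by (auto simp: indicator_def frac_le)
    then show "AE y in \<mu> n. norm (indicator ?C y / (y - x\<^sub>0)) \<le> 1 / c_seq Gn x\<^sub>0 n" by simp
  qed measurable
  have b: "b = (\<integral>y. indicator ?B y * ?x y \<partial>\<mu> n)"
    unfolding b_def set_lebesgue_integral_def
    by (rule Bochner_Integration.integral_cong) (auto simp: inv_sqrt_excess_def indicator_def)
  have q: "q = (\<integral>y. indicator ?C y / (y - x\<^sub>0) \<partial>\<mu> n)"
    unfolding q_def set_lebesgue_integral_def by simp
  have p: "p = (\<integral>y. indicator ?B y \<partial>\<mu> n)"
    unfolding p_def by simp
  have mean: "mean n = (\<integral>y. ?x y \<partial>\<mu> n)" by (rule V_of_eq)
  have one: "measure (\<mu> n) UNIV = 1"
    using R.prob_space by simp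
  have "(\<integral>y. excess_dev n y * indicator {-1<..<1} (excess_dev n y) \<partial>\<mu> n)
      = (\<integral>y. (?x y - mean n - indicator ?B y * ?x y + mean n * indicator ?B y) / scale n \<partial>\<mu> n)"
    unfolding trunc by (rule Bochner_Integration.integral_cong)
      (auto simp: excess_dev_def indicator_def diff_divide_distrib add_divide_distrib)
  also have "\<dots> = (mean n - mean n - b + mean n * p) / scale n"
    unfolding b p using ix ib ip by (simp add: mean[symmetric] one del: integral_indicator)
  finally show "(\<integral>y. excess_dev n y * indicator {-1<..<1} (excess_dev n y) \<partial>\<mu> n) = (mean n * p - b) / scale n"
    by simp
  have sq: "(excess_dev n y)\<^sup>2 * (1 - indicator ?B y)
      = (indicator ?C y / (y - x\<^sub>0) - 2 * mean n * (?x y - indicator ?B y * ?x y)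
          + (mean n)\<^sup>2 * (1 - indicator ?B y)) / (scale n)\<^sup>2" for y
  proof (cases "y \<in> ?B")
    case False
    have "(?x y)\<^sup>2 = indicator ?C y / (y - x\<^sub>0)"
      using False c by (auto simp: inv_sqrt_excess_def indicator_def power_divide)
    then show ?thesis using False by (simp add: excess_dev_def power_divide power2_diff mult_ac)
  next
    case True
    then have "indicator ?C y = (0 :: real)" by (auto simp: indicator_def)
    with True show ?thesis by simp
  qed
  have "(\<integral>y. (excess_dev n y)\<^sup>2 * indicator {-1<..<1} (excess_dev n y) \<partial>\<mu> n)
      = (\<integral>y. (indicator ?C y / (y - x\<^sub>0) - 2 * mean n * (?x y - indicator ?B y * ?x y)
          + (mean n)\<^sup>2 * (1 - indicator ?B y)) / (scale n)\<^sup>2 \<partial>\<mu> n)"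
    unfolding trunc sq ..
  also have "\<dots> = (q - 2 * mean n * (mean n - b) + (mean n)\<^sup>2 * (1 - p)) / (scale n)\<^sup>2"
    unfolding b p q using ix ib ip iq by (simp add: mean[symmetric] one del: integral_indicator)
  finally show "(\<integral>y. (excess_dev n y)\<^sup>2 * indicator {-1<..<1} (excess_dev n y) \<partial>\<mu> n)
      = (q - 2 * mean n * (mean n - b) + (mean n)\<^sup>2 * (1 - p)) / (scale n)\<^sup>2" .
qed

text \<open>With \<open>s\<^sup>2 = n log n\<close>, the bound \<open>\<delta> s \<le> \<xi>\<close> places \<open>Y\<close> within \<open>1 / (\<delta>\<^sup>2 n log n)\<close> to the right of
\<open>x\<^sub>0\<close>, which is the event in the tail hypothesis; the case \<open>\<delta> = 1\<close> covers the cutoff interval.  Since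
\<open>n / s = 1 / eps_seq n\<close>, the contribution of the cutoff interval to \<open>n\<close> times the truncated mean is
exactly the quotient that the small-o hypothesis controls.\<close>

lemma excess_dev_central_limit:
  assumes mean: "(\<lambda>n. mean n) \<longlonglongrightarrow> L" and "L > 0"
    and tail: "\<And>\<epsilon>. \<epsilon> > 0 \<Longrightarrow> (\<lambda>n. real n *
      (Gn n (x\<^sub>0 + 1 / (\<epsilon>\<^sup>2 * real n * ln (real n))) - Gn n x\<^sub>0)) \<longlonglongrightarrow> 0"
    and near: "(\<lambda>n. LINT y:cutoff n|\<mu> n. 1 / sqrt (y - x\<^sub>0)) \<in> o(eps_seq)"
    and far: "(\<lambda>n. 1 / ln (real n) * (LINT y:{x\<^sub>0 + c_seq Gn x\<^sub>0 n<..}|\<mu> n. 1 / (y - x\<^sub>0))) \<longlonglongrightarrow> v"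
    and "v > 0"
  shows "weak_conv_m (\<lambda>n. distr M borel (\<lambda>\<omega>. \<Sum>i=1..n. excess_dev n (Yn n i \<omega>))) (centered_normal v)"
proof (rule rowwise_iid_central_limit_theorem)
  define \<nu> where "\<nu> n = distr (\<mu> n) borel (excess_dev n)" for n
  define b where "b n = (LINT y:cutoff n|\<mu> n. 1 / sqrt (y - x\<^sub>0))" for n
  define q where "q n = (LINT y:{x\<^sub>0 + c_seq Gn x\<^sub>0 n<..}|\<mu> n. 1 / (y - x\<^sub>0))" for n
  define p where "p n = measure (\<mu> n) (cutoff n)" for n
  show "indep_vars (\<lambda>_. borel) (\<lambda>i \<omega>. excess_dev n (Yn n i \<omega>)) {1..n}" for n
    by (rule Yn_compose(1)) measurable
  show "distr M borel (\<lambda>\<omega>. excess_dev n (Yn n i \<omega>)) = \<nu> n" if "i \<in> {1..n}" for n i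
    unfolding \<nu>_def by (rule Yn_compose(2)) (use that in auto)
  have scale: "filterlim scale at_top sequentially"
    unfolding scale_def by (rule sqrt_n_ln_n_at_top)
  have ev: "\<forall>\<^sub>F n in sequentially. n \<ge> 2 \<and> 0 < mean n \<and> mean n < L + 1 \<and> L + 1 < \<delta> * scale n" if "\<delta> > 0" for \<delta>
  proof (intro eventually_conj eventually_ge_at_top order_tendstoD[OF mean])
    have "\<forall>\<^sub>F n in sequentially. (L + 1) / \<delta> < scale n"
      using scale by (simp add: filterlim_at_top_dense)
    then show "\<forall>\<^sub>F n in sequentially. L + 1 < \<delta> * scale n"
      by eventually_elim (use that in \<open>simp add: field_simps\<close>)
  qed (use \<open>L > 0\<close> in simp_all)
  have scale2: "(scale n)\<^sup>2 = real n * ln (real n)" if "n \<ge> 2" for n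
    unfolding scale_def using eps_seq_facts(2)[OF that] .
  show "(\<lambda>n. real n * measure (\<nu> n) {x. \<delta> \<le> \<bar>x\<bar>}) \<longlonglongrightarrow> 0" if "\<delta> > 0" for \<delta>
  proof (rule tendsto_sandwich[OF _ _ tendsto_const tail[OF that]])
    show "\<forall>\<^sub>F n in sequentially. real n * measure (\<nu> n) {x. \<delta> \<le> \<bar>x\<bar>}
        \<le> real n * (Gn n (x\<^sub>0 + 1 / (\<delta>\<^sup>2 * real n * ln (real n))) - Gn n x\<^sub>0)"
      using ev[OF that]
    proof eventually_elim
      case (elim n)
      then interpret R: real_distribution "\<mu> n" by (intro \<mu>_dist) simp
      have s: "scale n > 0" using elim eps_seq_facts(1)[of n] by (simp add: scale_def)
      define e where "e = 1 / (\<delta> * scale n)\<^sup>2"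
      have e: "e = 1 / (\<delta>\<^sup>2 * real n * ln (real n))"
        using elim scale2[of n] by (simp add: e_def power_mult_distrib mult_ac)
      have "excess_dev n -` {x. \<delta> \<le> \<bar>x\<bar>} \<subseteq> {x\<^sub>0<..x\<^sub>0 + e}"
      proof
        fix y assume "y \<in> excess_dev n -` {x. \<delta> \<le> \<bar>x\<bar>}"
        then have "\<delta> * scale n \<le> \<bar>inv_sqrt_excess x\<^sub>0 y - mean n\<bar>"
          using s by (simp add: excess_dev_def abs_divide field_simps)
        then have "\<delta> * scale n \<le> inv_sqrt_excess x\<^sub>0 y"
          using elim inv_sqrt_excess_nonneg[of x\<^sub>0 y] by linarith
        then show "y \<in> {x\<^sub>0<..x\<^sub>0 + e}"
          using inv_sqrt_excess_le_iff[of "\<delta> * scale n" y] that s by (simp add: e_def)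
      qed
      then have "measure (\<mu> n) (excess_dev n -` {x. \<delta> \<le> \<bar>x\<bar>}) \<le> measure (\<mu> n) {x\<^sub>0<..x\<^sub>0 + e}"
        by (intro R.finite_measure_mono) auto
      also have "\<dots> = Gn n (x\<^sub>0 + e) - Gn n x\<^sub>0"
        using elim by (intro distribution_function_measure_Ioc Gn_df) (auto simp: e_def)
      also have "measure (\<mu> n) (excess_dev n -` {x. \<delta> \<le> \<bar>x\<bar>}) = measure (\<nu> n) {x. \<delta> \<le> \<bar>x\<bar>}"
        unfolding \<nu>_def by (subst measure_distr) auto
      finally show ?case unfolding e by (rule mult_left_mono) simp
    qed
  qed simp
  have p0: "(\<lambda>n. real n * p n) \<longlonglongrightarrow> 0"
  proof (rule tendsto_sandwich[OF _ _ tendsto_const tail[OF zero_less_one]])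
    show "\<forall>\<^sub>F n in sequentially. real n * p n
        \<le> real n * (Gn n (x\<^sub>0 + 1 / (1\<^sup>2 * real n * ln (real n))) - Gn n x\<^sub>0)"
      using ev[OF zero_less_one]
    proof eventually_elim
      case (elim n)
      then interpret R: real_distribution "\<mu> n" by (intro \<mu>_dist) simp
      have s: "scale n > 0" using elim eps_seq_facts(1)[of n] by (simp add: scale_def)
      have "c_seq Gn x\<^sub>0 n \<le> 1 / (scale n)\<^sup>2"
        unfolding c_seq_def scale_def[symmetric] using elim s by (intro divide_left_mono power_mono) auto
      then have "p n \<le> measure (\<mu> n) {x\<^sub>0<..x\<^sub>0 + 1 / (scale n)\<^sup>2}"
        unfolding p_def by (intro R.finite_measure_mono) auto
      also have "\<dots> = Gn n (x\<^sub>0 + 1 / (scale n)\<^sup>2) - Gn n x\<^sub>0"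
        using elim by (intro distribution_function_measure_Ioc Gn_df) auto
      finally show ?case using elim scale2[of n] by (intro mult_left_mono) simp_all
    qed
  qed (simp add: p_def)
  have b0: "(\<lambda>n. b n / eps_seq n) \<longlonglongrightarrow> 0"
    unfolding b_def by (rule smalloD_tendsto[OF near])
  have inv_scale: "(\<lambda>n. 1 / scale n) \<longlonglongrightarrow> 0"
    by (intro tendsto_divide_0[OF tendsto_const] filterlim_at_top_imp_at_infinity scale)
  have inv_ln: "(\<lambda>n. 1 / ln (real n)) \<longlonglongrightarrow> 0"
    by (intro tendsto_divide_0[OF tendsto_const] filterlim_at_top_imp_at_infinity
        filterlim_compose[OF ln_at_top filterlim_real_sequentially])
  show "(\<lambda>n. real n * (\<integral>x. x * indicator {-1<..<1} x \<partial>\<nu> n)) \<longlonglongrightarrow> 0"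
  proof (rule Lim_transform_eventually)
    show "(\<lambda>n. mean n * (real n * p n) * (1 / scale n) - b n / eps_seq n) \<longlonglongrightarrow> 0"
      using tendsto_diff[OF tendsto_mult[OF tendsto_mult[OF mean p0] inv_scale] b0] by simp
    show "\<forall>\<^sub>F n in sequentially. mean n * (real n * p n) * (1 / scale n) - b n / eps_seq n
        = real n * (\<integral>x. x * indicator {-1<..<1} x \<partial>\<nu> n)"
      using ev[OF zero_less_one]
    proof eventually_elim
      case (elim n)
      have "(\<integral>x. x * indicator {-1<..<1} x \<partial>\<nu> n) = (mean n * p n - b n) / scale n"
        unfolding \<nu>_def b_def p_def using elim
        by (subst integral_distr) (simp_all add: excess_dev_truncated_moments(1))
      moreover have "1 / eps_seq n = real n / scale n"
        using elim eps_seq_facts(3)[of n] by (simp add: scale_def)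
      then have "b n / eps_seq n = b n * real n / scale n"
        by (metis divide_inverse inverse_eq_divide mult.assoc)
      ultimately show ?case by (simp add: diff_divide_distrib right_diff_distrib mult_ac)
    qed
  qed
  have p1: "p \<longlonglongrightarrow> 0"
  proof (rule Lim_transform_eventually)
    show "(\<lambda>n. (real n * p n) * (1 / real n)) \<longlonglongrightarrow> 0"
      using tendsto_mult[OF p0 lim_1_over_n] by simp
    show "\<forall>\<^sub>F n in sequentially. (real n * p n) * (1 / real n) = p n"
      using eventually_gt_at_top[of 0] by eventually_elim simp
  qed
  have b1: "b \<longlonglongrightarrow> 0"
  proof (rule Lim_transform_eventually)
    have "eps_seq \<longlonglongrightarrow> sqrt 0"
      unfolding eps_seq_def[abs_def]
      using lim_ln_over_n by (intro tendsto_real_sqrt) simp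
    from tendsto_mult[OF b0 this] show "(\<lambda>n. (b n / eps_seq n) * eps_seq n) \<longlonglongrightarrow> 0"
      by (simp only: real_sqrt_zero mult_zero_right)
    show "\<forall>\<^sub>F n in sequentially. (b n / eps_seq n) * eps_seq n = b n"
      using eventually_ge_at_top[of 2]
      by eventually_elim (use eps_seq_facts(4) in \<open>force\<close>)
  qed
  show "(\<lambda>n. real n * (\<integral>x. x\<^sup>2 * indicator {-1<..<1} x \<partial>\<nu> n)) \<longlonglongrightarrow> v"
  proof (rule Lim_transform_eventually)
    have "(\<lambda>n. 1 / ln (real n) * q n + (1 / ln (real n)) * ((mean n)\<^sup>2 * (1 - p n) - 2 * mean n * (mean n - b n)))
        \<longlonglongrightarrow> v + 0 * (L\<^sup>2 * (1 - 0) - 2 * L * (L - 0))"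
      unfolding q_def by (intro tendsto_intros far inv_ln mean p1 b1)
    then show "(\<lambda>n. 1 / ln (real n) * q n + (1 / ln (real n)) * ((mean n)\<^sup>2 * (1 - p n) - 2 * mean n * (mean n - b n)))
        \<longlonglongrightarrow> v" by simp
    show "\<forall>\<^sub>F n in sequentially. 1 / ln (real n) * q n
          + (1 / ln (real n)) * ((mean n)\<^sup>2 * (1 - p n) - 2 * mean n * (mean n - b n))
        = real n * (\<integral>x. x\<^sup>2 * indicator {-1<..<1} x \<partial>\<nu> n)"
      using ev[OF zero_less_one]
    proof eventually_elim
      case (elim n)
      have "(\<integral>x. x\<^sup>2 * indicator {-1<..<1} x \<partial>\<nu> n)
          = (q n - 2 * mean n * (mean n - b n) + (mean n)\<^sup>2 * (1 - p n)) / (scale n)\<^sup>2"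
        unfolding \<nu>_def b_def p_def q_def using elim
        by (subst integral_distr) (simp_all add: excess_dev_truncated_moments(2))
      then have "real n * (\<integral>x. x\<^sup>2 * indicator {-1<..<1} x \<partial>\<nu> n)
          = real n * ((q n - 2 * mean n * (mean n - b n) + (mean n)\<^sup>2 * (1 - p n)) / (real n * ln (real n)))"
        using elim scale2[of n] by simp
      also have "\<dots> = (q n - 2 * mean n * (mean n - b n) + (mean n)\<^sup>2 * (1 - p n)) / ln (real n)"
        using elim by simp
      finally show ?case
        by (simp add: add_divide_distrib diff_divide_distrib)
    qed
  qed
qed fact

text \<open>For \<open>n \<le> 1\<close> both sides are \<open>0\<close> because of the division by \<open>eps_seq n = 0\<close>, so the identity holds for all
\<open>n\<close>.\<close>

lemma F_diff:
  "(F_of (V_emp n (\<lambda>i. Yn n i \<omega>)) x\<^sub>0 - F_of (V_of (Gn n)) x\<^sub>0) / eps_seq n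
    = - (2 / pi * sqrt x\<^sub>0) * (\<Sum>i=1..n. excess_dev n (Yn n i \<omega>))
      + - (2 / pi) * ((\<Sum>i=1..n. angle_dev n (Yn n i \<omega>)) / real n) / eps_seq n"
proof (cases "n \<ge> 2")
  case True
  then have n: "n \<ge> 1" by simp
  let ?V = "V_emp n (\<lambda>i. Yn n i \<omega>)"
  note e = V_emp_integral[OF x0_pos, of n "\<lambda>i. Yn n i \<omega>"] and v = V_of_integral[OF x0_pos \<mu>_dist[OF n]]
  have "(LINT u:{x\<^sub>0<..}|lborel. (?V u - V_of (Gn n) u) / (2 * sqrt u))
      = (LINT u:{x\<^sub>0<..}|lborel. ?V u / (2 * sqrt u)) - (LINT u:{x\<^sub>0<..}|lborel. V_of (Gn n) u / (2 * sqrt u))"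
    using set_integral_diff(2)[OF e(1) v(1)] by (simp add: diff_divide_distrib)
  then have int: "(LINT u:{x\<^sub>0<..}|lborel. ?V u / (2 * sqrt u)) - (LINT u:{x\<^sub>0<..}|lborel. V_of (Gn n) u / (2 * sqrt u))
      = (\<Sum>i=1..n. angle_dev n (Yn n i \<omega>)) / real n"
    using integral_V_diff[OF n, of "\<lambda>i. Yn n i \<omega>"] by simp
  have inv: "1 / eps_seq n = real n / scale n"
    using eps_seq_facts(3)[OF True] by (simp add: scale_def)
  have s: "scale n > 0" using eps_seq_facts(1)[OF True] by (simp add: scale_def)
  have "(?V x\<^sub>0 - mean n) / eps_seq n = (?V x\<^sub>0 - mean n) * (1 / eps_seq n)" by simp
  also have "\<dots> = (\<Sum>i=1..n. excess_dev n (Yn n i \<omega>))"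
    unfolding inv V_emp_eq excess_dev_def using s n
    by (simp add: sum_divide_distrib[symmetric] sum_subtractf field_simps)
  finally have val: "(?V x\<^sub>0 - mean n) / eps_seq n = (\<Sum>i=1..n. excess_dev n (Yn n i \<omega>))" .
  have "F_of ?V x\<^sub>0 - F_of (V_of (Gn n)) x\<^sub>0
      = - (2 / pi * sqrt x\<^sub>0) * (?V x\<^sub>0 - mean n) + - (2 / pi) * ((\<Sum>i=1..n. angle_dev n (Yn n i \<omega>)) / real n)"
    unfolding int[symmetric] F_of_def by (simp add: algebra_simps)
  then show ?thesis by (simp only: add_divide_distrib times_divide_eq_right[symmetric] val)
next
  case False
  then have "n = 0 \<or> n = 1" by auto
  then show ?thesis by (auto simp: eps_seq_def excess_dev_def scale_def)
qed

text \<open>By independence the second moment of the sum is at most \<open>4 n\<close>, and \<open>n eps_seq n\<^sup>2 = log n\<close> tends to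
infinity.\<close>

lemma angle_remainder:
  defines "Q \<equiv> \<lambda>n \<omega>. - (2 / pi) * ((\<Sum>i=1..n. angle_dev n (Yn n i \<omega>)) / real n) / eps_seq n"
  shows "integrable M (\<lambda>\<omega>. (Q n \<omega>)\<^sup>2)" and "(\<lambda>n. expectation (\<lambda>\<omega>. (Q n \<omega>)\<^sup>2)) \<longlonglongrightarrow> 0"
proof -
  define k where "k n = (- (2 / pi) / real n / eps_seq n)\<^sup>2" for n
  let ?S = "\<lambda>n \<omega>. \<Sum>i=1..n. angle_dev n (Yn n i \<omega>)"
  have Q2: "(Q n \<omega>)\<^sup>2 = k n * (?S n \<omega>)\<^sup>2" for n \<omega>
    by (simp add: Q_def k_def power_divide power_mult_distrib)
  have S: "integrable M (\<lambda>\<omega>. (?S n \<omega>)\<^sup>2) \<and>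
      expectation (\<lambda>\<omega>. (?S n \<omega>)\<^sup>2) = (\<Sum>i=1..n. expectation (\<lambda>\<omega>. (angle_dev n (Yn n i \<omega>))\<^sup>2))" for n
  proof (rule second_moment_sum_indep)
    show "indep_vars (\<lambda>_. borel) (\<lambda>i \<omega>. angle_dev n (Yn n i \<omega>)) {1..n}"
      by (rule Yn_compose(1)) measurable
    fix i assume i: "i \<in> {1..n}"
    then have n: "n \<ge> 1" by simp
    show "expectation (\<lambda>\<omega>. angle_dev n (Yn n i \<omega>)) = 0"
      using Yn_integral[OF angle_dev_measurable i] angle_dev_moments(2)[OF n] by simp
    have "integrable (distr M borel (Yn n i)) (\<lambda>y. (angle_dev n y)\<^sup>2)"
      unfolding Yn_law[OF i] by (rule angle_dev_moments(3)[OF n])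
    then show "integrable M (\<lambda>\<omega>. (angle_dev n (Yn n i \<omega>))\<^sup>2)"
      by (rule integrable_distr[OF Yn_measurable[OF i]])
  qed simp
  show "integrable M (\<lambda>\<omega>. (Q n \<omega>)\<^sup>2)"
    unfolding Q2 using S[of n] by (intro integrable_mult_right) simp
  have E: "expectation (\<lambda>\<omega>. (Q n \<omega>)\<^sup>2) \<le> 4 * (2 / pi)\<^sup>2 * (1 / ln (real n))" if "n \<ge> 2" for n
  proof -
    have n: "n \<ge> 1" using that by simp
    have "(\<Sum>i=1..n. expectation (\<lambda>\<omega>. (angle_dev n (Yn n i \<omega>))\<^sup>2)) \<le> (\<Sum>i=1..n. 4)"
    proof (rule sum_mono)
      fix i assume i: "i \<in> {1..n}"
      have "expectation (\<lambda>\<omega>. (angle_dev n (Yn n i \<omega>))\<^sup>2) = (\<integral>y. (angle_dev n y)\<^sup>2 \<partial>\<mu> n)"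
        by (rule Yn_integral[OF _ i]) measurable
      with angle_dev_moments(4)[OF n] show "expectation (\<lambda>\<omega>. (angle_dev n (Yn n i \<omega>))\<^sup>2) \<le> 4" by simp
    qed
    then have "expectation (\<lambda>\<omega>. (Q n \<omega>)\<^sup>2) \<le> k n * (4 * real n)"
      unfolding Q2 using S[of n] by (simp add: k_def mult_left_mono)
    also have "\<dots> = 4 * (2 / pi)\<^sup>2 * (1 / ln (real n))"
      using that by (simp add: k_def eps_seq_def power_divide field_simps power2_eq_square)
    finally show ?thesis .
  qed
  show "(\<lambda>n. expectation (\<lambda>\<omega>. (Q n \<omega>)\<^sup>2)) \<longlonglongrightarrow> 0"
  proof (rule tendsto_sandwich[OF _ _ tendsto_const])
    show "\<forall>\<^sub>F n in sequentially. expectation (\<lambda>\<omega>. (Q n \<omega>)\<^sup>2) \<le> 4 * (2 / pi)\<^sup>2 * (1 / ln (real n))"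
      using eventually_ge_at_top[of 2] by eventually_elim (rule E)
    have "(\<lambda>n. 1 / ln (real n)) \<longlonglongrightarrow> 0"
      by (intro tendsto_divide_0[OF tendsto_const] filterlim_at_top_imp_at_infinity
          filterlim_compose[OF ln_at_top filterlim_real_sequentially])
    from tendsto_mult[OF tendsto_const this, of "4 * (2 / pi)\<^sup>2"]
    show "(\<lambda>n. 4 * (2 / pi)\<^sup>2 * (1 / ln (real n))) \<longlonglongrightarrow> 0" by simp
  qed simp
qed

end

theorem proposition2p2:
  fixes N :: "'b measure" and X :: "'b \<Rightarrow> real ^ 3" and \<rho> :: "real \<Rightarrow> real"
    and Y :: "'b \<Rightarrow> real" and G :: "real \<Rightarrow> real"
    and M :: "'a measure" and T :: "nat \<Rightarrow> 'a \<Rightarrow> real"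
    and Gn :: "nat \<Rightarrow> real \<Rightarrow> real" and Yn :: "nat \<Rightarrow> nat \<Rightarrow> 'a \<Rightarrow> real"
    and x\<^sub>0 \<sigma>2 :: real
  assumes "prob_space N"
    and "\<And>z. z \<ge> 0 \<Longrightarrow> \<rho> z \<ge> 0"
    and "distributed N lborel X (\<lambda>x. ennreal (\<rho> ((x $ 1)\<^sup>2 + (x $ 2)\<^sup>2 + (x $ 3)\<^sup>2)))"
    and "\<And>\<omega>. Y \<omega> = (X \<omega> $ 1)\<^sup>2 + (X \<omega> $ 2)\<^sup>2"
    and "G = cdf (distr N borel Y)"
    and "prob_space M"
    and "prob_space.indep_vars M (\<lambda>_. borel) T {1..}"
    and "\<And>i. i \<ge> 1 \<Longrightarrow> distr M borel (T i) = uniform_measure lborel {0<..<1}"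
    and "\<And>n. n \<ge> 1 \<Longrightarrow> distribution_function_nonneg (Gn n)"
    and "\<And>n i \<omega>. Yn n i \<omega> = quantile (Gn n) (T i \<omega>)"
    and "x\<^sub>0 > 0"
    and "\<sigma>2 = prob_space.variance N (\<lambda>\<omega>. arcsin (sqrt (min 1 (x\<^sub>0 / Y \<omega>))))"
    and "sq_density \<rho> x\<^sub>0 > 0"
    and "(\<lambda>n. SUP t. \<bar>Gn n t - G t\<bar>) \<longlonglongrightarrow> 0"
  shows "weak_conv_m
      (\<lambda>n. distr M borel (\<lambda>\<omega>. sqrt (real n) *
         (LINT u:{x\<^sub>0<..}|lborel. (V_emp n (\<lambda>i. Yn n i \<omega>) u - V_of (Gn n) u) / (2 * sqrt u))))
      (centered_normal \<sigma>2)
    \<and> ((\<lambda>n. V_of (Gn n) x\<^sub>0) \<longlonglongrightarrow> V_model \<rho> x\<^sub>0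
       \<and> (\<forall>\<epsilon>>0. (\<lambda>n. real n *
            (Gn n (x\<^sub>0 + 1 / (\<epsilon>\<^sup>2 * real n * ln (real n))) - Gn n x\<^sub>0)) \<longlonglongrightarrow> 0)
       \<and> (\<lambda>n. LINT y:{x\<^sub>0<..x\<^sub>0 + c_seq Gn x\<^sub>0 n}|interval_measure (Gn n). 1 / sqrt (y - x\<^sub>0))
            \<in> o(eps_seq)
       \<and> (\<lambda>n. 1 / ln (real n) *
            (LINT y:{x\<^sub>0 + c_seq Gn x\<^sub>0 n<..}|interval_measure (Gn n). 1 / (y - x\<^sub>0)))
            \<longlonglongrightarrow> sq_density \<rho> x\<^sub>0
       \<longrightarrow> weak_conv_m
            (\<lambda>n. distr M borel (\<lambda>\<omega>.
               (F_of (V_emp n (\<lambda>i. Yn n i \<omega>)) x\<^sub>0 - F_of (V_of (Gn n)) x\<^sub>0) / eps_seq n))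
            (centered_normal (4 / pi\<^sup>2 * x\<^sub>0 * sq_density \<rho> x\<^sub>0)))"
proof -
  interpret S: spherical_model N X \<rho> x\<^sub>0
    using assms by (intro spherical_model.intro spherical_model_axioms.intro) auto
  interpret A: quantile_array M T Gn Yn x\<^sub>0
    using assms by (intro quantile_array.intro quantile_array_axioms.intro) auto
  have Y: "Y = S.Y" using assms(4) by auto
  let ?\<nu> = "distr N borel S.Y"
  interpret \<nu>: real_distribution ?\<nu> by (rule S.real_distribution_distr[OF S.Y_measurable])
  have G: "G = cdf ?\<nu>" using assms(5) Y by simp
  have Gn_lim: "(\<lambda>n. Gn n t) \<longlonglongrightarrow> G t" for t
  proof -
    have "\<bar>Gn n t - G t\<bar> \<le> (SUP t. \<bar>Gn n t - G t\<bar>)" if "n \<ge> 1" for n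
    proof (rule cSUP_upper)
      have "\<bar>Gn n t - G t\<bar> \<le> 1" for t
        using distribution_function_le_1[OF assms(9)[OF that], of t] \<nu>.cdf_bounded_prob[of t]
          distribution_function_nonneg_val[OF assms(9)[OF that], of t] \<nu>.cdf_nonneg[of t]
        unfolding G by linarith
      then show "bdd_above (range (\<lambda>t. \<bar>Gn n t - G t\<bar>))" by (auto intro!: bdd_aboveI2)
    qed simp
    then have "\<forall>\<^sub>F n in sequentially. norm (Gn n t - G t) \<le> (SUP t. \<bar>Gn n t - G t\<bar>)"
      by (auto simp: eventually_sequentially)
    from Lim_null_comparison[OF this assms(14)] show ?thesis
      by (rule LIM_zero_cancel)
  qed
  \<comment> \<open>\<open>Gn 0\<close> is arbitrary, hence the shift by one\<close>
  have weak: "weak_conv_m (\<lambda>n. A.\<mu> (Suc n)) ?\<nu>"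
    unfolding weak_conv_m_def weak_conv_def
  proof (intro allI impI)
    fix t
    show "(\<lambda>n. cdf (A.\<mu> (Suc n)) t) \<longlonglongrightarrow> cdf ?\<nu> t"
      using LIMSEQ_Suc[OF Gn_lim[of t]] unfolding G
      by (simp add: distribution_function_cdf[OF A.Gn_df])
  qed
  have integral_lim: "(\<lambda>n. \<integral>y. (tail_angle x\<^sub>0 y) ^ k \<partial>A.\<mu> n) \<longlonglongrightarrow> S.expectation (\<lambda>\<omega>. (tail_angle x\<^sub>0 (S.Y \<omega>)) ^ k)"
    for k
  proof -
    have cont: "isCont (\<lambda>y. (tail_angle x\<^sub>0 y) ^ k) y" for y
      using continuous_on_tail_angle[OF assms(11)]
      by (intro isCont_power) (simp add: continuous_on_eq_continuous_at)
    have meas: "(\<lambda>y. (tail_angle x\<^sub>0 y) ^ k) \<in> borel_measurable borel"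
      using tail_angle_measurable[OF assms(11)] by measurable
    have "norm ((tail_angle x\<^sub>0 y) ^ k) \<le> (pi / 2) ^ k" for y
      using tail_angle_bounds[OF assms(11), of y] by (simp add: norm_power power_mono)
    then have "(\<lambda>n. \<integral>y. (tail_angle x\<^sub>0 y) ^ k \<partial>A.\<mu> (Suc n)) \<longlonglongrightarrow> (\<integral>y. (tail_angle x\<^sub>0 y) ^ k \<partial>?\<nu>)"
      by (intro weak_conv_imp_integral_bdd_continuous_conv[OF A.\<mu>_dist \<nu>.real_distribution_axioms weak cont]) auto
    also have "(\<integral>y. (tail_angle x\<^sub>0 y) ^ k \<partial>?\<nu>) = S.expectation (\<lambda>\<omega>. (tail_angle x\<^sub>0 (S.Y \<omega>)) ^ k)"
      by (rule integral_distr[OF S.Y_measurable meas])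
    finally show ?thesis by (rule LIMSEQ_imp_Suc)
  qed
  have sigma: "\<sigma>2 = S.expectation (\<lambda>\<omega>. (tail_angle x\<^sub>0 (S.Y \<omega>))\<^sup>2) - (S.expectation (\<lambda>\<omega>. tail_angle x\<^sub>0 (S.Y \<omega>)))\<^sup>2"
    unfolding assms(12) Y S.variance_arcsin by (rule S.variance_eq[OF S.tail_angle_Y_integrable])
  have sigma_pos: "\<sigma>2 > 0"
    unfolding assms(12) Y S.variance_arcsin by (rule S.variance_tail_angle_pos)
  have var: "(\<lambda>n. \<integral>y. (A.angle_dev n y)\<^sup>2 \<partial>A.\<mu> n) \<longlonglongrightarrow> \<sigma>2"
  proof (rule Lim_transform_eventually)
    show "(\<lambda>n. (\<integral>y. (tail_angle x\<^sub>0 y)\<^sup>2 \<partial>A.\<mu> n) - (\<integral>y. tail_angle x\<^sub>0 y \<partial>A.\<mu> n)\<^sup>2) \<longlonglongrightarrow> \<sigma>2"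
      unfolding sigma using integral_lim[of 1] integral_lim[of 2] by (intro tendsto_intros) simp_all
    show "\<forall>\<^sub>F n in sequentially. (\<integral>y. (tail_angle x\<^sub>0 y)\<^sup>2 \<partial>A.\<mu> n) - (\<integral>y. tail_angle x\<^sub>0 y \<partial>A.\<mu> n)\<^sup>2
        = (\<integral>y. (A.angle_dev n y)\<^sup>2 \<partial>A.\<mu> n)"
      using eventually_ge_at_top[of 1]
    proof eventually_elim
      case (elim n)
      interpret R: real_distribution "A.\<mu> n" by (rule A.\<mu>_dist[OF elim])
      have "\<bar>tail_angle x\<^sub>0 y\<bar> \<le> \<bar>pi / 2\<bar>" for y
        using tail_angle_bounds[OF assms(11), of y] by simp
      then have "norm ((tail_angle x\<^sub>0 y)\<^sup>2) \<le> (pi / 2)\<^sup>2" for y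
        unfolding real_norm_def abs_power2 by (rule abs_le_square_iff[THEN iffD1])
      then have "integrable (A.\<mu> n) (\<lambda>y. (tail_angle x\<^sub>0 y)\<^sup>2)"
        using tail_angle_measurable[OF assms(11)]
        by (intro R.integrable_const_bound[where B = "(pi / 2)\<^sup>2"] borel_measurable_power AE_I2) auto
      from R.variance_eq[OF A.tail_angle_integrable[OF elim] this] show ?case
        by (simp add: A.angle_dev_def A.angle_mean_def)
    qed
  qed
  have first: "sqrt (real n) * (LINT u:{x\<^sub>0<..}|lborel. (V_emp n (\<lambda>i. Yn n i \<omega>) u - V_of (Gn n) u) / (2 * sqrt u))
      = (\<Sum>i=1..n. A.angle_dev n (Yn n i \<omega>) / sqrt (real n))" for n \<omega>
  proof (cases "n \<ge> 1")
    case True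
    then show ?thesis
      unfolding A.integral_V_diff[OF True] sum_divide_distrib[symmetric]
      by (simp add: real_div_sqrt field_simps)
  qed simp
  have part1: "weak_conv_m
      (\<lambda>n. distr M borel (\<lambda>\<omega>. sqrt (real n) *
         (LINT u:{x\<^sub>0<..}|lborel. (V_emp n (\<lambda>i. Yn n i \<omega>) u - V_of (Gn n) u) / (2 * sqrt u))))
      (centered_normal \<sigma>2)"
    unfolding first by (rule A.angle_dev_central_limit[OF var sigma_pos])
  have part2: "weak_conv_m
            (\<lambda>n. distr M borel (\<lambda>\<omega>.
               (F_of (V_emp n (\<lambda>i. Yn n i \<omega>)) x\<^sub>0 - F_of (V_of (Gn n)) x\<^sub>0) / eps_seq n))
            (centered_normal (4 / pi\<^sup>2 * x\<^sub>0 * sq_density \<rho> x\<^sub>0))"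
    if 1: "(\<lambda>n. V_of (Gn n) x\<^sub>0) \<longlonglongrightarrow> V_model \<rho> x\<^sub>0"
      and 2: "\<forall>\<epsilon>>0. (\<lambda>n. real n *
            (Gn n (x\<^sub>0 + 1 / (\<epsilon>\<^sup>2 * real n * ln (real n))) - Gn n x\<^sub>0)) \<longlonglongrightarrow> 0"
      and 3: "(\<lambda>n. LINT y:{x\<^sub>0<..x\<^sub>0 + c_seq Gn x\<^sub>0 n}|interval_measure (Gn n). 1 / sqrt (y - x\<^sub>0)) \<in> o(eps_seq)"
      and 4: "(\<lambda>n. 1 / ln (real n) *
            (LINT y:{x\<^sub>0 + c_seq Gn x\<^sub>0 n<..}|interval_measure (Gn n). 1 / (y - x\<^sub>0)))
            \<longlonglongrightarrow> sq_density \<rho> x\<^sub>0"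
  proof -
    have var_eq: "4 / pi\<^sup>2 * x\<^sub>0 * sq_density \<rho> x\<^sub>0 = (- (2 / pi * sqrt x\<^sub>0))\<^sup>2 * sq_density \<rho> x\<^sub>0"
      using assms(11) by (simp add: power_mult_distrib power_divide)
    have P: "weak_conv_m (\<lambda>n. distr M borel (\<lambda>\<omega>. \<Sum>i=1..n. A.excess_dev n (Yn n i \<omega>)))
        (centered_normal (sq_density \<rho> x\<^sub>0))"
      using 2 by (intro A.excess_dev_central_limit[OF 1 S.V_model_pos _ 3 4 assms(13)]) auto
    have [measurable]: "(\<lambda>\<omega>. f n (Yn n i \<omega>)) \<in> borel_measurable M"
      if "f n \<in> borel_measurable borel" "i \<in> {1..n}" for f :: "nat \<Rightarrow> real \<Rightarrow> real" and n i
      by (rule measurable_compose[OF A.Yn_measurable]) (use that in auto)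
    show ?thesis
      unfolding A.F_diff var_eq
    proof (rule A.weak_conv_normal_affine_perturbation[OF _ _ P assms(13) _ A.angle_remainder])
      show "(\<lambda>\<omega>. \<Sum>i=1..n. A.excess_dev n (Yn n i \<omega>)) \<in> borel_measurable M" for n
        by (intro borel_measurable_sum measurable_compose[OF A.Yn_measurable A.excess_dev_measurable])
      show "(\<lambda>\<omega>. - (2 / pi) * ((\<Sum>i=1..n. A.angle_dev n (Yn n i \<omega>)) / real n) / eps_seq n) \<in> borel_measurable M" for n
        by (intro borel_measurable_divide borel_measurable_times borel_measurable_const borel_measurable_sum
            measurable_compose[OF A.Yn_measurable A.angle_dev_measurable])
    qed (use assms(11) in simp)
  qed
  from part1 part2 show ?thesis by blast
qed

end
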